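(* Assume: (i) $\|A\|_\infty<\infty$, $\|B_0\|_\infty<\infty$, $\|B\|_\infty<\infty$; (ii) for any $\lambda\ge0$, $q_\lambda(0)=0$, $q_\lambda$ is right-continuous at $0$ and differentiable on $(0,\infty)$, and $\sup_{\lambda>0}\sup_{x>0}|q'_\lambda(x)|/\lambda<\infty$; (iii) $\theta_\star\in\mathcal M$ and for every $s\in\mathcal S$ the set $\{\ell\in\mathcal S\setminus\{s\}:\ \theta_\star(s,\ell)\neq0\}$ is finite; (iv) $n^{-1}\lambda_n=o(1)$ as $n\to\infty$; (v) for any $\theta\in\mathcal M$ and any $s\in\mathcal S$, the infinite matrix $\rho^{(s)}_\theta$ is positive definite. Let $\{\hat\theta_n,\ n\ge1\}$ be a Borel measurable sequence of $\mathcal M_1$ (i.e. of random elements of $\mathcal M_1$) such that $\hat\theta_n\in\mathrm{Argmax}\,Q_n$. If $\{\hat\theta_n-\theta_\star^{(n)},\ n\ge1\}$ is uniformly tight as a random sequence of $\mathcal M_1$, then $\|\hat\theta_n-\theta_\star^{(n)}\|_1$ converges in probability to zero as $n\to\infty$.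
   Context: Setting. $\mathsf X$ is a compact subset of a Euclidean space with Borel sigma-algebra and a finite (non-zero) measure $\rho$; densities are with respect to $\rho$. $A,B_0:\mathsf X\to\mathbb R$, $B:\mathsf X\times\mathsf X\to\mathbb R$ are measurable, $B(x,y)=B(y,x)$, $B(x,x)=B_0(x)$. $\mathcal S$ is a countably infinite set with a linear ordering $\succeq$. For $\Lambda\subseteq\mathcal S$, $\underline\Lambda^2=\{(s,\ell)\in\Lambda\times\Lambda:\ \ell\succeq s\}$. $\mathcal M$ is the space of symmetric infinite matrices $\theta:\mathcal S\times\mathcal S\to\mathbb R$ with $\sum_{\ell\ne s}|\theta(s,\ell)|<\infty$ for all $s$. $\mathcal M_1$ is the separable Banach space of $\theta\in\mathcal M$ with $\|\theta\|_1=\sum_{(s,\ell)\in\underline{\mathcal S}^2}|\theta(s,\ell)|<\infty$. Full conditional densities: for $\theta\in\mathcal M$, $s\in\mathcal S$, $u\in\mathsf X$, $x\in\mathsf X^{\mathcal S\setminus\{s\}}$, $$f^{(s)}_\theta(u\mid x)=\frac1{Z^{(s)}_\theta}\exp\Big\{A(u)+\theta(s,s)B_0(u)+\sum_{\ell\in\mathcal S\setminus\{s\}}\theta(s,\ell)B(u,x_\ell)\Big\},$$ $Z^{(s)}_\theta=Z^{(s)}_\theta(x)$ the normalizing constant. $\mu_\theta$ denotes a probability measure on $\mathsf X^{\mathcal S}$ such that, if $\{X_s\}_{s\in\mathcal S}\sim\mu_\theta$, then for every $s$ the conditional distribution of $X_s$ given $\{X_\ell,\ell\neq s\}$ has density $f^{(s)}_\theta(\cdot\mid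 X_{\mathcal S\setminus\{s\}})$; such a measure exists (possibly not unique; one is fixed). $\mathbb E_\star$ is expectation under $\mu_{\theta_\star}$, where $\theta_\star$ is the true matrix. $X^{(1)},X^{(2)},\dots$ are i.i.d. with law $\mu_{\theta_\star}$ on a probability space with probability $\check{\mathbb P}_\star$ (convergence in probability and tightness refer to it). $\{D_n\}$ is an increasing sequence of finite subsets of $\mathcal S$ with union $\mathcal S$. $\mathcal M^{(n)}$ is the space of real symmetric matrices indexed by $D_n\times D_n$, viewed as infinite matrices vanishing outside $D_n\times D_n$; for $\theta\in\mathcal M$, $\theta^{(n)}\in\mathcal M^{(n)}$ equals $\theta$ on $D_n\times D_n$ and $0$ elsewhere. With $\partial_n s=D_n\setminus\{s\}$, for $s\in D_n$, $$f^{(s)}_\theta(u\mid x_{\partial_n s})=\frac1{Z^{(s)}_{n,\theta}}\exp\Big(A(u)+\theta(s,s)B_0(u)+\sum_{\ell\in\partial_n s}\theta(s,\ell)B(u,x_\ell)\Big),$$ with $Z^{(s)}_{n,\theta}$ the normalizing constant. For penalty functions $q_\lambda:[0,\infty)\to[0,\infty)$ ($\lambda\ge0$) and $\lambda_n>0$, $$Q_n(\theta)=\sum_{i=1}^n\sum_{s\in D_n}\log f^{(s)}_\theta(X^{(i)}_s\mid X^{(i)}_{\partial_n s})-\sum_{(s,\ell)\in\underline D_n^2}q_{\lambda_n}(|\theta(s,\ell)|),\quad\theta\in\mathcal M^{(n)},$$ and $\mathrm{Argmax}\,Q_n=\{\theta\in\mathcal M^{(n)}:\ Q_n(\theta)=\sup_{\vartheta\in\mathcal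 M^{(n)}}Q_n(\vartheta)\}$. For $\theta\in\mathcal M$, $s\in\mathcal S$, the infinite matrix $\rho^{(s)}_\theta=\{\rho^{(s)}_\theta(\ell,\ell'),\ \ell,\ell'\in\mathcal S\}$ is $$\rho^{(s)}_\theta(\ell,\ell')=\mathbb E_\star\big[\mathrm{Cov}_\theta\big(B(X_s,X_\ell),B(X_s,X_{\ell'})\mid X_{\mathcal S\setminus\{s\}}\big)\big],$$ where the conditional covariance is computed with $X_s$ distributed according to the density $f^{(s)}_\theta(\cdot\mid X_{\mathcal S\setminus\{s\}})$ and the other coordinates held fixed (so $B(X_s,X_s)=B_0(X_s)$ when $\ell=s$), and the outer expectation is over $X_{\mathcal S\setminus\{s\}}$ under $\mu_{\theta_\star}$. Positive definite means $\sum_{\ell,\ell'\in\mathcal S}v_\ell v_{\ell'}\rho^{(s)}_\theta(\ell,\ell')>0$ for every non-zero absolutely summable real family $v=(v_\ell)_{\ell\in\mathcal S}$. *)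

theory Defs
  imports "HOL-Probability.Probability"
begin

section \<open>Spaces of infinite symmetric matrices\<close>

definition lower_pairs :: "'s::linorder set \<Rightarrow> ('s \<times> 's) set" where
  "lower_pairs \<Lambda> = {(s, l). s \<in> \<Lambda> \<and> l \<in> \<Lambda> \<and> s \<le> l}"

definition sym_mats :: "('s \<Rightarrow> 's \<Rightarrow> real) set" where
  "sym_mats = {\<theta>. (\<forall>s l. \<theta> s l = \<theta> l s) \<and>
                   (\<forall>s. (\<lambda>l. \<bar>\<theta> s l\<bar>) summable_on (UNIV - {s}))}"

definition sym_mats1 :: "('s::linorder \<Rightarrow> 's \<Rightarrow> real) set" where
  "sym_mats1 = {\<theta> \<in> sym_mats. (\<lambda>(s, l). \<bar>\<theta> s l\<bar>) summable_on lower_pairs UNIV}"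

definition norm1 :: "('s::linorder \<Rightarrow> 's \<Rightarrow> real) \<Rightarrow> real" where
  "norm1 \<theta> = (\<Sum>\<^sub>\<infinity>(s, l)\<in>lower_pairs UNIV. \<bar>\<theta> s l\<bar>)"

definition top1 :: "('s::linorder \<Rightarrow> 's \<Rightarrow> real) topology" where
  "top1 = Metric_space.mtopology sym_mats1 (\<lambda>\<theta> \<eta>. norm1 (\<theta> - \<eta>))"

definition borel1 :: "('s::linorder \<Rightarrow> 's \<Rightarrow> real) measure" where
  "borel1 = sigma sym_mats1 {U. openin top1 U}"

definition fin_mats :: "'s set \<Rightarrow> ('s \<Rightarrow> 's \<Rightarrow> real) set" where
  "fin_mats \<Lambda> = {\<theta>. (\<forall>s l. \<theta> s l = \<theta> l s) \<and>
                     (\<forall>s l. (s, l) \<notin> \<Lambda> \<times> \<Lambda> \<longrightarrow> \<theta> s l = 0)}"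

definition truncate :: "'s set \<Rightarrow> ('s \<Rightarrow> 's \<Rightarrow> real) \<Rightarrow> 's \<Rightarrow> 's \<Rightarrow> real" where
  "truncate \<Lambda> \<theta> = (\<lambda>s l. if s \<in> \<Lambda> \<and> l \<in> \<Lambda> then \<theta> s l else 0)"

lemma norm1_Metric_space:
  "Metric_space sym_mats1 (\<lambda>\<theta> \<eta> :: 's::linorder \<Rightarrow> 's \<Rightarrow> real. norm1 (\<theta> - \<eta>))"
proof -
  have summ: "(\<lambda>(s, l). \<bar>(\<theta> - \<eta>) s l\<bar>) summable_on lower_pairs UNIV"
    if "\<theta> \<in> sym_mats1" "\<eta> \<in> sym_mats1" for \<theta> \<eta> :: "'s \<Rightarrow> 's \<Rightarrow> real"
  proof -
    have "(\<lambda>p. (case p of (s, l) \<Rightarrow> \<bar>\<theta> s l\<bar>) + (case p of (s, l) \<Rightarrow> \<bar>\<eta> s l\<bar>))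
            summable_on lower_pairs UNIV"
      using that by (intro summable_on_add) (auto simp: sym_mats1_def)
    then show ?thesis
      by (rule summable_on_comparison_test) auto
  qed
  show ?thesis
  proof
    fix \<theta> \<eta> :: "'s \<Rightarrow> 's \<Rightarrow> real"
    show "0 \<le> norm1 (\<theta> - \<eta>)"
      unfolding norm1_def by (rule infsum_nonneg) auto
    show "norm1 (\<theta> - \<eta>) = norm1 (\<eta> - \<theta>)"
      unfolding norm1_def by (rule infsum_cong) auto
  next
    fix \<theta> \<eta> :: "'s \<Rightarrow> 's \<Rightarrow> real"
    assume m: "\<theta> \<in> sym_mats1" "\<eta> \<in> sym_mats1"
    show "norm1 (\<theta> - \<eta>) = 0 \<longleftrightarrow> \<theta> = \<eta>"
    proof
      assume z: "norm1 (\<theta> - \<eta>) = 0"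
      have le: "\<theta> s l = \<eta> s l" if "s \<le> l" for s l
      proof -
        have "(case (s, l) of (s, l) \<Rightarrow> \<bar>(\<theta> - \<eta>) s l\<bar>) = 0"
          by (rule nonneg_infsum_le_0D[where A = "lower_pairs UNIV"])
             (use z summ[OF m] that in \<open>auto simp: norm1_def lower_pairs_def\<close>)
        then show ?thesis by simp
      qed
      show "\<theta> = \<eta>"
      proof (intro ext)
        fix s l
        have "\<theta> s l = \<theta> l s" "\<eta> s l = \<eta> l s"
          using m by (auto simp: sym_mats1_def sym_mats_def)
        then show "\<theta> s l = \<eta> s l"
          using le[of s l] le[of l s] linear[of s l] by auto
      qed
    qed (simp add: norm1_def case_prod_unfold)
  next
    fix \<theta> \<eta> \<zeta> :: "'s \<Rightarrow> 's \<Rightarrow> real"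
    assume m: "\<theta> \<in> sym_mats1" "\<eta> \<in> sym_mats1" "\<zeta> \<in> sym_mats1"
    have "norm1 (\<theta> - \<zeta>) \<le> (\<Sum>\<^sub>\<infinity>p\<in>lower_pairs UNIV.
        (case p of (s, l) \<Rightarrow> \<bar>(\<theta> - \<eta>) s l\<bar>) + (case p of (s, l) \<Rightarrow> \<bar>(\<eta> - \<zeta>) s l\<bar>))"
      unfolding norm1_def
      by (intro infsum_mono summable_on_add summ m) auto
    also have "\<dots> = norm1 (\<theta> - \<eta>) + norm1 (\<eta> - \<zeta>)"
      unfolding norm1_def by (intro infsum_add summ m)
    finally show "norm1 (\<theta> - \<zeta>) \<le> norm1 (\<theta> - \<eta>) + norm1 (\<eta> - \<zeta>)" .
  qed
qed


section \<open>Conditional densities and the random field\<close>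

text \<open>
  The base measure \<open>\<rho>\<close> lives on the compact set of states, so \<open>space \<rho>\<close> is that set; configurations
  are functions \<open>x\<close> from the sites to states.  \<open>N\<close> is the set of sites other than \<open>s\<close> that enter
  the interaction sum: \<open>UNIV - {s}\<close> gives the full conditional density at \<open>s\<close>, and \<open>\<Lambda> - {s}\<close>
  gives the one used in the pseudo-likelihood on \<open>\<Lambda>\<close>.  The value \<open>x s\<close> is never used when
  \<open>s \<notin> N\<close>.
\<close>

definition cond_weight ::
  "('x \<Rightarrow> real) \<Rightarrow> ('x \<Rightarrow> real) \<Rightarrow> ('x \<Rightarrow> 'x \<Rightarrow> real) \<Rightarrow> ('s \<Rightarrow> 's \<Rightarrow> real) \<Rightarrow> 's set \<Rightarrow> 's
    \<Rightarrow> ('s \<Rightarrow> 'x) \<Rightarrow> 'x \<Rightarrow> real" where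
  "cond_weight A B0 B \<theta> N s x u =
     exp (A u + \<theta> s s * B0 u + (\<Sum>\<^sub>\<infinity>l\<in>N. \<theta> s l * B u (x l)))"

definition cond_density ::
  "'x measure \<Rightarrow> ('x \<Rightarrow> real) \<Rightarrow> ('x \<Rightarrow> real) \<Rightarrow> ('x \<Rightarrow> 'x \<Rightarrow> real) \<Rightarrow> ('s \<Rightarrow> 's \<Rightarrow> real) \<Rightarrow> 's set
    \<Rightarrow> 's \<Rightarrow> ('s \<Rightarrow> 'x) \<Rightarrow> 'x \<Rightarrow> real" where
  "cond_density \<rho> A B0 B \<theta> N s x u =
     cond_weight A B0 B \<theta> N s x u / (\<integral>w. cond_weight A B0 B \<theta> N s x w \<partial>\<rho>)"

abbreviation full_cond_density ::
  "'x measure \<Rightarrow> ('x \<Rightarrow> real) \<Rightarrow> ('x \<Rightarrow> real) \<Rightarrow> ('x \<Rightarrow> 'x \<Rightarrow> real) \<Rightarrow> ('s \<Rightarrow> 's \<Rightarrow> real)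
    \<Rightarrow> 's \<Rightarrow> ('s \<Rightarrow> 'x) \<Rightarrow> 'x \<Rightarrow> real" where
  "full_cond_density \<rho> A B0 B \<theta> s \<equiv> cond_density \<rho> A B0 B \<theta> (UNIV - {s}) s"

text \<open>The sub-sigma-algebra generated by all coordinates other than \<open>s\<close>.\<close>

definition sigma_others :: "'x measure \<Rightarrow> 's \<Rightarrow> ('s \<Rightarrow> 'x) measure" where
  "sigma_others \<rho> s = vimage_algebra (space (\<Pi>\<^sub>M l\<in>UNIV. \<rho>))
     (\<lambda>x. restrict x (UNIV - {s})) (\<Pi>\<^sub>M l\<in>UNIV - {s}. \<rho>)"

text \<open>
  \<open>\<mu>\<close> is a probability measure on configurations for which the conditional distribution of the
  coordinate \<open>s\<close> given all others has the full conditional density with respect to \<open>\<rho>\<close>.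
  Only the sigma-algebra of the product \<open>\<Pi>\<^sub>M l\<in>UNIV. \<rho>\<close> is used; \<open>\<rho>\<close> need not be a probability
  measure.
\<close>

definition field_law ::
  "'x measure \<Rightarrow> ('x \<Rightarrow> real) \<Rightarrow> ('x \<Rightarrow> real) \<Rightarrow> ('x \<Rightarrow> 'x \<Rightarrow> real) \<Rightarrow> ('s \<Rightarrow> 's \<Rightarrow> real)
    \<Rightarrow> ('s \<Rightarrow> 'x) measure \<Rightarrow> bool" where
  "field_law \<rho> A B0 B \<theta> \<mu> \<longleftrightarrow>
     prob_space \<mu> \<and> sets \<mu> = sets (\<Pi>\<^sub>M l\<in>UNIV. \<rho>) \<and>
     (\<forall>s. \<forall>C\<in>sets \<rho>. AE x in \<mu>.
        real_cond_exp \<mu> (sigma_others \<rho> s) (\<lambda>y. indicator C (y s)) x =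
        (\<integral>u. indicator C u * full_cond_density \<rho> A B0 B \<theta> s x u \<partial>\<rho>))"


section \<open>The matrix of expected conditional covariances\<close>

definition cov :: "'a measure \<Rightarrow> ('a \<Rightarrow> real) \<Rightarrow> ('a \<Rightarrow> real) \<Rightarrow> real" where
  "cov M f g = (\<integral>w. (f w - (\<integral>v. f v \<partial>M)) * (g w - (\<integral>v. g v \<partial>M)) \<partial>M)"

text \<open>
  Resampling the coordinate \<open>s\<close> replaces \<open>x\<close> by \<open>x(s := u)\<close>; for \<open>l = s\<close> the statistic is then
  \<open>B u u\<close>.
\<close>

definition cov_matrix ::
  "'x measure \<Rightarrow> ('x \<Rightarrow> real) \<Rightarrow> ('x \<Rightarrow> real) \<Rightarrow> ('x \<Rightarrow> 'x \<Rightarrow> real) \<Rightarrow> ('s \<Rightarrow> 'x) measure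
    \<Rightarrow> ('s \<Rightarrow> 's \<Rightarrow> real) \<Rightarrow> 's \<Rightarrow> 's \<Rightarrow> 's \<Rightarrow> real" where
  "cov_matrix \<rho> A B0 B \<mu> \<theta> s l l' =
     (\<integral>x. cov (density \<rho> (\<lambda>u. ennreal (full_cond_density \<rho> A B0 B \<theta> s x u)))
             (\<lambda>u. B u ((x(s := u)) l)) (\<lambda>u. B u ((x(s := u)) l')) \<partial>\<mu>)"

definition pos_def_matrix :: "('s \<Rightarrow> 's \<Rightarrow> real) \<Rightarrow> bool" where
  "pos_def_matrix R \<longleftrightarrow>
     (\<forall>v :: 's \<Rightarrow> real. (\<lambda>l. \<bar>v l\<bar>) summable_on UNIV \<longrightarrow> (\<exists>l. v l \<noteq> 0) \<longrightarrow>
        (\<Sum>\<^sub>\<infinity>(l, l')\<in>UNIV. v l * v l' * R l l') > 0)"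


section \<open>The penalized pseudo-likelihood and its maximizers\<close>

text \<open>
  \<open>\<xi> 1, \<dots>, \<xi> n\<close> is the sample, \<open>\<Lambda>\<close> the finite set of observed sites and \<open>p\<close> the penalty
  function.
\<close>

definition pen_pseudo_lik ::
  "'x measure \<Rightarrow> ('x \<Rightarrow> real) \<Rightarrow> ('x \<Rightarrow> real) \<Rightarrow> ('x \<Rightarrow> 'x \<Rightarrow> real) \<Rightarrow> (real \<Rightarrow> real) \<Rightarrow> 's::linorder set
    \<Rightarrow> nat \<Rightarrow> (nat \<Rightarrow> 's \<Rightarrow> 'x) \<Rightarrow> ('s \<Rightarrow> 's \<Rightarrow> real) \<Rightarrow> real" where
  "pen_pseudo_lik \<rho> A B0 B p \<Lambda> n \<xi> \<theta> =
     (\<Sum>i = 1..n. \<Sum>s\<in>\<Lambda>. ln (cond_density \<rho> A B0 B \<theta> (\<Lambda> - {s}) s (\<xi> i) (\<xi> i s)))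
     - (\<Sum>(s, l)\<in>lower_pairs \<Lambda>. p \<bar>\<theta> s l\<bar>)"

text \<open>The supremum is taken in the extended reals, where it always exists.\<close>

definition Argmax :: "'a set \<Rightarrow> ('a \<Rightarrow> real) \<Rightarrow> 'a set" where
  "Argmax T Q = {\<theta> \<in> T. ereal (Q \<theta>) = (SUP \<eta>\<in>T. ereal (Q \<eta>))}"


section \<open>Uniform tightness and convergence in probability\<close>

definition uniformly_tight ::
  "'w measure \<Rightarrow> 'a topology \<Rightarrow> 'i set \<Rightarrow> ('i \<Rightarrow> 'w \<Rightarrow> 'a) \<Rightarrow> bool" where
  "uniformly_tight P T I Y \<longleftrightarrow>
     (\<forall>\<epsilon>>0. \<exists>K. compactin T K \<and>
        (\<forall>n\<in>I. measure P {\<omega> \<in> space P. Y n \<omega> \<in> K} \<ge> 1 - \<epsilon>))"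

definition tendsto_in_prob :: "'w measure \<Rightarrow> (nat \<Rightarrow> 'w \<Rightarrow> real) \<Rightarrow> real \<Rightarrow> bool" where
  "tendsto_in_prob P Y c \<longleftrightarrow>
     (\<forall>\<epsilon>>0. (\<lambda>n. measure P {\<omega> \<in> space P. \<bar>Y n \<omega> - c\<bar> > \<epsilon>}) \<longlonglongrightarrow> 0)"

end

theory Submission
  imports Defs "HOL-Library.Function_Algebras"
begin

text \<open>
  Wald's argument.  Write \<open>\<Delta>\<close> for the difference of the estimator and the truncated true matrix.
  Conditionally on the other coordinates, the expected log likelihood ratio at site \<open>s\<close> between
  \<open>\<theta>star + \<Delta>\<close> and \<open>\<theta>star\<close> is \<open>E h - ln (E (exp h))\<close>, where \<open>h\<close> is the energy of \<open>\<Delta>\<close>; this is at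
  most \<open>- \<kappa> Var h\<close>, and the expected variance is the quadratic form of the covariance matrix at
  row \<open>s\<close> of \<open>\<Delta>\<close>, hence positive unless that row vanishes.  Log likelihood ratios at \<open>s\<close> are Lipschitz
  in the \<open>l1\<close> norm of row \<open>s\<close>, and these row norms sum to at most \<open>2 \<parallel>\<Delta>\<parallel>\<close>; so around each \<open>\<Delta> \<noteq> 0\<close> the
  sum over all sites is controlled by finitely many of them and, by the law of large numbers, is
  negative of order \<open>n\<close> on a whole ball, which a maximizer cannot allow as the penalty only
  contributes \<open>o(n)\<close>.  Tightness reduces the claim to finitely many such balls.
\<close>

section \<open>Infinite sums, exponential moments and a law of large numbers\<close>

text \<open>Both the sites and the parameters grow in number with the sample size, so a
  probabilistic bound on the whole pseudo-likelihood is out of reach. Randomness is used only at a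
  finite set \<open>F\<close> of sites chosen for one fixed candidate error
  \<open>\<Delta>0\<close>; at all other sites the estimates hold for every sample, with Lipschitz
  constant \<open>2 * b\<close>: one \<open>b\<close> for the energy, one for the log normalizing
  constant. A second obstacle is that the competitor open to the maximizer is the truncated matrix,
  not \<open>\<theta>star\<close>. Its log likelihood at a site is the true one once the neighbours
  of that site under \<open>\<theta>star\<close> lie in \<open>D n\<close>. Finite neighbourhoods
  make this true on all of \<open>F\<close> for large \<open>n\<close>; elsewhere only the Lipschitz
  bound is used. Third, \<open>field_law\<close> speaks about conditional probabilities of events at
  one site. The lemma \<open>resample\<close> turns this into invariance of \<open>\<mu>\<close>
  under redrawing one coordinate, so that an expected gain becomes an average of gains under the
  conditional laws \<open>\<nu> s x\<close>. The constant \<open>\<kappa>\<close> must then be the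
  same for all \<open>x\<close>, which boundedness of the energy provides.\<close>

lemma abs_summable_reals_bounded:
  fixes g c :: "'i \<Rightarrow> real"
  assumes "\<And>i. \<bar>g i\<bar> \<le> c i" "c summable_on UNIV"
  shows "g summable_on UNIV" "(\<lambda>i. \<bar>g i\<bar>) summable_on UNIV"
proof -
  show *: "(\<lambda>i. \<bar>g i\<bar>) summable_on UNIV"
    using assms(2) by (rule summable_on_comparison_test) (use assms(1) in auto)
  show "g summable_on UNIV"
    by (rule abs_summable_summable) (use * in simp)
qed

lemma borel_measurable_uncurry_countable:
  fixes g :: "'i::countable \<Rightarrow> 'a \<Rightarrow> real"
  assumes [measurable]: "\<And>i. g i \<in> borel_measurable M"
  shows "(\<lambda>(x, i). g i x) \<in> borel_measurable (M \<Otimes>\<^sub>M count_space UNIV)"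
  unfolding case_prod_unfold
  by (rule measurable_compose_countable[where f = "\<lambda>i p. g i (fst p)"]) measurable

text \<open>The summable bound \<open>c\<close> makes each series absolutely convergent, hence a
  Bochner integral over counting measure, and integrals depending on a parameter are
  measurable.\<close>

lemma borel_measurable_infsum_bounded:
  fixes g :: "'i::countable \<Rightarrow> 'a \<Rightarrow> real"
  assumes [measurable]: "\<And>i. g i \<in> borel_measurable M"
    and bnd: "\<And>i x. x \<in> space M \<Longrightarrow> \<bar>g i x\<bar> \<le> c i" and c: "c summable_on UNIV"
  shows "(\<lambda>x. \<Sum>\<^sub>\<infinity>i. g i x) \<in> borel_measurable M"
proof -
  have eq: "(\<Sum>\<^sub>\<infinity>i. g i x) = (\<integral>i. g i x \<partial>count_space UNIV)" if "x \<in> space M" for x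
    using abs_summable_reals_bounded(2)[of "\<lambda>i. g i x" c] bnd[OF that] c
    by (subst infsetsum_infsum[symmetric])
       (auto simp: infsetsum_def abs_summable_equivalent[symmetric])
  have [measurable]: "(\<lambda>(x, i). g i x) \<in> borel_measurable (M \<Otimes>\<^sub>M count_space UNIV)"
    by (rule borel_measurable_uncurry_countable) auto
  interpret sigma_finite_measure "count_space (UNIV :: 'i set)"
    by (rule sigma_finite_measure_count_space)
  have "(\<lambda>x. \<integral>i. g i x \<partial>count_space UNIV) \<in> borel_measurable M"
    by measurable
  then show ?thesis
    using eq by (simp cong: measurable_cong)
qed

text \<open>Fubini for \<open>M\<close> and counting measure; the integrable majorant on the product
  is \<open>c\<close>, constant in the first variable.\<close>

lemma integral_infsum_bounded:
  fixes g :: "'i::countable \<Rightarrow> 'a \<Rightarrow> real"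
  assumes M: "finite_measure M" and [measurable]: "\<And>i. g i \<in> borel_measurable M"
    and bnd: "\<And>i x. x \<in> space M \<Longrightarrow> \<bar>g i x\<bar> \<le> c i" and c: "c summable_on UNIV"
  shows "(\<integral>x. (\<Sum>\<^sub>\<infinity>i. g i x) \<partial>M) = (\<Sum>\<^sub>\<infinity>i. \<integral>x. g i x \<partial>M)"
proof -
  interpret finite_measure M by fact
  interpret C: sigma_finite_measure "count_space (UNIV :: 'i set)"
    by (rule sigma_finite_measure_count_space)
  interpret pair_sigma_finite M "count_space (UNIV :: 'i set)" ..
  show ?thesis
  \<comment> \<open>On an empty space \<open>bnd\<close> is vacuous and \<open>c\<close> may be
    negative, but then all integrals vanish.\<close>
  proof (cases "space M = {}")
    case True
    then have "(\<integral>x. h x \<partial>M) = 0" for h :: "'a \<Rightarrow> real"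
      by (intro integral_eq_zero_AE AE_I2) auto
    then show ?thesis by simp
  next
    case False
    then obtain x0 where x0: "x0 \<in> space M" by auto
    have c0: "c i \<ge> 0" for i
      using bnd[OF x0, of i] by linarith
    have eq: "(\<Sum>\<^sub>\<infinity>i. h i) = (\<integral>i. h i \<partial>count_space UNIV)"
      if "\<And>i. \<bar>h i\<bar> \<le> d i" "d summable_on UNIV" for h d :: "'i \<Rightarrow> real"
      using abs_summable_reals_bounded(2)[of h d] that
      by (subst infsetsum_infsum[symmetric])
         (auto simp: infsetsum_def abs_summable_equivalent[symmetric])
    have intc: "integrable (count_space UNIV) c"
    proof -
      have "Infinite_Set_Sum.abs_summable_on c UNIV"
        unfolding abs_summable_equivalent[symmetric] using c c0 by simp
      then show ?thesis by (simp add: Infinite_Set_Sum.abs_summable_on_def)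
    qed
    have m[measurable]: "(\<lambda>(x, i). g i x) \<in> borel_measurable (M \<Otimes>\<^sub>M count_space UNIV)"
      by (rule borel_measurable_uncurry_countable) auto
    have int: "integrable (M \<Otimes>\<^sub>M count_space UNIV) (\<lambda>(x, i). g i x)"
    proof (rule Bochner_Integration.integrable_bound)
      show "integrable (M \<Otimes>\<^sub>M count_space UNIV) (\<lambda>(x, i). c i)"
      proof (rule Fubini_integrable)
        show "(\<lambda>(x, i). c i) \<in> borel_measurable (M \<Otimes>\<^sub>M count_space UNIV)"
          by (rule borel_measurable_uncurry_countable) auto
        show "AE x in M. integrable (count_space UNIV) (\<lambda>i. case (x, i) of (x, i) \<Rightarrow> c i)"
          using intc by simp
      qed simp
      show "AE p in M \<Otimes>\<^sub>M count_space UNIV. norm (case p of (x, i) \<Rightarrow> g i x)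
              \<le> norm (case p of (x, i) \<Rightarrow> c i)"
        using bnd c0 by (intro AE_I2) (auto simp: space_pair_measure)
    qed (rule m)
    have "(\<integral>x. (\<Sum>\<^sub>\<infinity>i. g i x) \<partial>M) = (\<integral>x. (\<integral>i. g i x \<partial>count_space UNIV) \<partial>M)"
      by (intro Bochner_Integration.integral_cong refl eq[where d = c] bnd c)
    also have "\<dots> = (\<integral>i. (\<integral>x. g i x \<partial>M) \<partial>count_space UNIV)"
      using Fubini_integral[of "\<lambda>x i. g i x"] int by simp
    also have "\<dots> = (\<Sum>\<^sub>\<infinity>i. \<integral>x. g i x \<partial>M)"
    proof (rule eq[symmetric, where d = "\<lambda>i. c i * measure M (space M)"])
      show "(\<lambda>i. c i * measure M (space M)) summable_on UNIV"
        using c by (rule summable_on_cmult_left)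
      fix i
      have "integrable M (g i)"
        by (rule integrable_const_bound[where B = "c i"]) (use bnd in auto)
      then have "\<bar>\<integral>x. g i x \<partial>M\<bar> \<le> (\<integral>x. \<bar>g i x\<bar> \<partial>M)"
        by simp
      also have "\<dots> \<le> (\<integral>x. c i \<partial>M)"
        using \<open>integrable M (g i)\<close> bnd by (intro integral_mono) auto
      finally show "\<bar>\<integral>x. g i x \<partial>M\<bar> \<le> c i * measure M (space M)"
        by (simp add: mult.commute)
    qed
    finally show ?thesis .
  qed
qed

text \<open>Second order Taylor expansion with Lagrange remainder; the intermediate point stays
  within \<open>T\<close> of 0, which bounds the remainder from below.\<close>

lemma exp_ge_quadratic:
  fixes t T :: real
  assumes "\<bar>t\<bar> \<le> T"
  shows "exp t \<ge> 1 + t + exp (- T) / 2 * t\<^sup>2"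
proof -
  obtain z where z: "\<bar>z\<bar> \<le> \<bar>t\<bar>" "exp t = (\<Sum>m<2. t ^ m / fact m) + exp z / fact 2 * t ^ 2"
    using Maclaurin_exp_le[of t 2] by blast
  have "exp (- T) \<le> exp z"
    using z(1) assms by simp
  then have "exp (- T) / 2 * t\<^sup>2 \<le> exp z / 2 * t\<^sup>2"
    by (intro mult_right_mono) auto
  then show ?thesis
    using z(2) by (simp add: numeral_2_eq_2)
qed

text \<open>A quantitative Jensen inequality. Deviations from the mean are at most
  \<open>2 * c\<close>, which gives the curvature constant \<open>k\<close> of
  \<open>exp_ge_quadratic\<close>, and the variance is at most four times the square of
  \<open>c\<close>. The order of quantifiers matters: one \<open>\<kappa>\<close> serves all
  measures and all \<open>h\<close> bounded by \<open>c\<close>, so it can be taken out of an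
  integral over conditional laws.\<close>

lemma jensen_exp_gap:
  fixes c :: real
  assumes "c \<ge> 0"
  shows "\<exists>\<kappa>>0. \<forall>(M :: 'a measure) h. prob_space M \<longrightarrow> h \<in> borel_measurable M \<longrightarrow>
           (\<forall>x\<in>space M. \<bar>h x\<bar> \<le> c) \<longrightarrow>
           (\<integral>x. h x \<partial>M) - ln (\<integral>x. exp (h x) \<partial>M) \<le> - \<kappa> * cov M h h"
proof -
  define k where "k = exp (- (2 * c)) / 2"
  have k: "k > 0" by (simp add: k_def)
  have pos: "1 + k * (4 * c\<^sup>2) > 0"
    using k by (intro add_pos_nonneg) auto
  have "(\<integral>x. h x \<partial>M) - ln (\<integral>x. exp (h x) \<partial>M) \<le> - (k / (1 + k * (4 * c\<^sup>2))) * cov M h h"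
    if M: "prob_space M" and [measurable]: "h \<in> borel_measurable M"
      and bnd: "\<And>x. x \<in> space M \<Longrightarrow> \<bar>h x\<bar> \<le> c" for M :: "'a measure" and h
  proof -
    interpret prob_space M by fact
    define m where "m = (\<integral>x. h x \<partial>M)"
    have ih: "integrable M h"
      by (rule integrable_const_bound[where B = c]) (use bnd in auto)
    have "\<bar>m\<bar> \<le> (\<integral>x. \<bar>h x\<bar> \<partial>M)" unfolding m_def by simp
    also have "\<dots> \<le> (\<integral>x. c \<partial>M)" using ih bnd by (intro integral_mono) auto
    finally have m: "\<bar>m\<bar> \<le> c" by (simp add: prob_space)
    have t: "\<bar>h x - m\<bar> \<le> 2 * c" if "x \<in> space M" for x
      using bnd[OF that] m by linarith
    have sq: "(h x - m)\<^sup>2 \<le> 4 * c\<^sup>2" if "x \<in> space M" for x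
      using power_mono[OF t[OF that], of 2] by (simp add: power_mult_distrib)
    have ie: "integrable M (\<lambda>x. exp (h x - m))"
      by (rule integrable_const_bound[where B = "exp (2 * c)"]) (use t in \<open>auto simp: abs_le_iff\<close>)
    have isq: "integrable M (\<lambda>x. (h x - m)\<^sup>2)"
      by (rule integrable_const_bound[where B = "4 * c\<^sup>2"]) (use sq in auto)
    define V where "V = (\<integral>x. (h x - m)\<^sup>2 \<partial>M)"
    have V0: "V \<ge> 0" unfolding V_def by simp
    have "V \<le> (\<integral>x. 4 * c\<^sup>2 \<partial>M)" unfolding V_def using isq sq by (intro integral_mono) auto
    then have V1: "V \<le> 4 * c\<^sup>2" by (simp add: prob_space)
    have "1 + k * V = (\<integral>x. 1 + (h x - m) + k * (h x - m)\<^sup>2 \<partial>M)"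
      using ih isq by (simp add: V_def m_def prob_space)
    also have "\<dots> \<le> (\<integral>x. exp (h x - m) \<partial>M)"
    proof (intro integral_mono ie)
      show "integrable M (\<lambda>x. 1 + (h x - m) + k * (h x - m)\<^sup>2)" using ih isq by auto
      show "1 + (h x - m) + k * (h x - m)\<^sup>2 \<le> exp (h x - m)" if "x \<in> space M" for x
        using exp_ge_quadratic[OF t[OF that]] by (simp add: k_def)
    qed
    also have "\<dots> = (\<integral>x. exp (h x) \<partial>M) / exp m"
      by (simp add: exp_diff)
    finally have E: "1 + k * V \<le> (\<integral>x. exp (h x) \<partial>M) / exp m" .
    have kV: "0 < 1 + k * V" using k V0 by (intro add_pos_nonneg) auto
    have "0 < (\<integral>x. exp (h x) \<partial>M) / exp m" using E kV by linarith
    then have epos: "(\<integral>x. exp (h x) \<partial>M) > 0" by (simp add: zero_less_divide_iff)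
    \<comment> \<open>The elementary bound \<open>1 - 1 / t \<le> ln t\<close> at
      \<open>t = 1 + k * V\<close> has \<open>V\<close> in the denominator; replacing it there by
      its upper bound leaves an estimate linear in \<open>V\<close>.\<close>
    have "k * V / (1 + k * (4 * c\<^sup>2)) \<le> k * V / (1 + k * V)"
      using k V0 V1 kV by (intro divide_left_mono) (auto intro!: mult_pos_pos pos)
    also have "\<dots> = 1 - 1 / (1 + k * V)" using kV by (simp add: field_simps)
    also have "\<dots> \<le> ln (1 + k * V)"
      using ln_le_minus_one[of "1 / (1 + k * V)"] kV by (simp add: ln_div)
    also have "\<dots> \<le> ln ((\<integral>x. exp (h x) \<partial>M) / exp m)"
      using E kV by simp
    also have "\<dots> = ln (\<integral>x. exp (h x) \<partial>M) - m"
      using epos by (simp add: ln_div)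
    finally show ?thesis
      unfolding cov_def m_def[symmetric] by (simp add: V_def power2_eq_square)
  qed
  then show ?thesis
    using k pos by (intro exI[of _ "k / (1 + k * (4 * c\<^sup>2))"]) auto
qed

text \<open>Mean value theorem on intervals in the nonnegative half-line. Since \<open>p\<close>
  need not be differentiable at 0, right-continuity there covers intervals that start at 0.\<close>

lemma penalty_lipschitz:
  fixes p :: "real \<Rightarrow> real"
  assumes cont: "continuous (at_right 0) p"
    and diff: "\<And>x. x > 0 \<Longrightarrow> p differentiable (at x)"
    and deriv: "\<And>x. x > 0 \<Longrightarrow> \<bar>deriv p x\<bar> \<le> C"
  shows "\<bar>p \<bar>y\<bar> - p \<bar>x\<bar>\<bar> \<le> C * \<bar>y - x\<bar>"
proof -
  have *: "\<bar>p y - p x\<bar> \<le> C * (y - x)" if "0 \<le> x" "x < y" for x y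
  proof -
    have "continuous_on {x..y} p"
      unfolding continuous_on_eq_continuous_within
    proof
      fix z assume z: "z \<in> {x..y}"
      show "continuous (at z within {x..y}) p"
      proof (cases "z = 0")
        case True
        then have "x = 0" using z that by simp
        have "continuous (at 0 within {0..y}) p"
          using that cont \<open>x = 0\<close> at_within_Icc_at_right[of 0 y] by simp
        then show ?thesis using True \<open>x = 0\<close> by simp
      next
        case False
        then have "z > 0" using z that by simp
        show ?thesis
          by (rule continuous_at_imp_continuous_at_within)
             (rule differentiable_imp_continuous_within[OF diff[OF \<open>z > 0\<close>]])
      qed
    qed
    moreover have "p differentiable (at z)" if "x < z" "z < y" for z
      by (rule diff) (use that \<open>0 \<le> x\<close> in simp)
    ultimately obtain l z where z: "x < z" "z < y" "(p has_real_derivative l) (at z)"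
        "p y - p x = (y - x) * l"
      using MVT[OF \<open>x < y\<close>, of p] by blast
    then have "\<bar>l\<bar> \<le> C" using deriv[of z] DERIV_imp_deriv[OF z(3)] that(1) z(1) by simp
    then show ?thesis
      using z that by (simp add: abs_mult mult.commute mult_right_mono)
  qed
  have C: "C \<ge> 0" using deriv[of 1] by simp
  have "\<bar>p \<bar>y\<bar> - p \<bar>x\<bar>\<bar> \<le> C * \<bar>\<bar>y\<bar> - \<bar>x\<bar>\<bar>"
    using *[of "\<bar>x\<bar>" "\<bar>y\<bar>"] *[of "\<bar>y\<bar>" "\<bar>x\<bar>"]
    by (cases "\<bar>x\<bar>" "\<bar>y\<bar>" rule: linorder_cases) (auto simp: abs_minus_commute)
  also have "\<dots> \<le> C * \<bar>y - x\<bar>"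
    using C by (intro mult_left_mono) auto
  finally show ?thesis .
qed

text \<open>Hoeffding's inequality: the sum has mean at most \<open>- (n * h)\<close>, so reaching
  half of that value is an upward deviation of at least \<open>n * h / 2\<close>, of exponentially
  small probability. Only this tail matters, because a maximizer can be favoured only by unusually
  large log likelihood ratios.\<close>

lemma weak_law_upper:
  fixes X :: "nat \<Rightarrow> 'w \<Rightarrow> 'c" and g :: "'c \<Rightarrow> real"
  assumes P: "prob_space P" and ind: "prob_space.indep_vars P (\<lambda>_. \<mu>) X {1..}"
    and law: "\<And>i. i \<ge> 1 \<Longrightarrow> distr P \<mu> (X i) = \<mu>"
    and g[measurable]: "g \<in> borel_measurable \<mu>" and bnd: "\<And>x. x \<in> space \<mu> \<Longrightarrow> \<bar>g x\<bar> \<le> c"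
    and h: "(\<integral>x. g x \<partial>\<mu>) \<le> - h" "h > 0"
  shows "(\<lambda>n. measure P {\<omega> \<in> space P. (\<Sum>i = 1..n. g (X i \<omega>)) \<ge> - (real n * h / 2)}) \<longlonglongrightarrow> 0"
proof -
  interpret prob_space P by fact
  \<comment> \<open>The added 1 keeps the Hoeffding intervals nondegenerate, as their squared
    lengths appear in a denominator.\<close>
  define d where "d = \<bar>c\<bar> + 1"
  then have d: "d > 0" by simp
  have rv[measurable]: "X i \<in> measurable P \<mu>" if "i \<ge> 1" for i
    using ind that unfolding indep_vars_def by auto
  have mX: "(\<lambda>\<omega>. g (X i \<omega>)) \<in> borel_measurable P" if "i \<ge> 1" for i
    using rv[OF that] g by (rule measurable_compose)
  have E: "expectation (\<lambda>\<omega>. g (X i \<omega>)) = (\<integral>x. g x \<partial>\<mu>)" if "i \<ge> 1" for i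
    using integral_distr[OF rv[OF that] g] law[OF that] by simp
  have b1: "\<bar>g (X i \<omega>)\<bar> \<le> d" if "i \<ge> 1" "\<omega> \<in> space P" for i \<omega>
    using bnd[of "X i \<omega>"] measurable_space[OF rv] that by (force simp: d_def)
  have bound: "measure P {\<omega> \<in> space P. (\<Sum>i = 1..n. g (X i \<omega>)) \<ge> - (real n * h / 2)}
      \<le> exp (- (h\<^sup>2 / (8 * d\<^sup>2)) * real n)" if n: "n \<ge> 1" for n
  proof -
    have ind': "indep_vars (\<lambda>_. borel) (\<lambda>i \<omega>. g (X i \<omega>)) {1..n}"
      by (rule indep_vars_compose2[where M' = "\<lambda>_. \<mu>" and Y = "\<lambda>_. g"])
         (use ind in \<open>auto intro: indep_vars_subset\<close>)
    interpret Hoeffding_ineq P "{1..n}" "\<lambda>i \<omega>. g (X i \<omega>)" "\<lambda>_. - d" "\<lambda>_. d"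
      "\<Sum>i = 1..n. expectation (\<lambda>\<omega>. g (X i \<omega>))"
    proof unfold_locales
      show "indep_vars (\<lambda>_. borel) (\<lambda>i \<omega>. g (X i \<omega>)) {1..n}" by fact
      show "AE \<omega> in P. g (X i \<omega>) \<in> {- d..d}" if "i \<in> {1..n}" for i
        using b1[of i] that by (intro AE_I2) (force simp: abs_le_iff)
    qed auto
    have "measure P {\<omega> \<in> space P. (\<Sum>i = 1..n. g (X i \<omega>)) \<ge> - (real n * h / 2)}
      \<le> measure P {\<omega> \<in> space P. (\<Sum>i = 1..n. g (X i \<omega>)) \<ge>
            (\<Sum>i = 1..n. expectation (\<lambda>\<omega>. g (X i \<omega>))) + real n * h / 2}"
    proof (rule finite_measure_mono)
      have "(\<Sum>i = 1..n. expectation (\<lambda>\<omega>. g (X i \<omega>))) \<le> - (real n * h)"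
        using E h(1) mult_left_mono[OF h(1), of "real n"] by simp
      then show "{\<omega> \<in> space P. (\<Sum>i = 1..n. g (X i \<omega>)) \<ge> - (real n * h / 2)} \<subseteq>
        {\<omega> \<in> space P. (\<Sum>i = 1..n. g (X i \<omega>)) \<ge>
            (\<Sum>i = 1..n. expectation (\<lambda>\<omega>. g (X i \<omega>))) + real n * h / 2}"
        by auto
      have [measurable]: "(\<lambda>\<omega>. \<Sum>i = 1..n. g (X i \<omega>)) \<in> borel_measurable P"
        by (rule borel_measurable_sum) (use mX in auto)
      show "{\<omega> \<in> space P. (\<Sum>i = 1..n. g (X i \<omega>)) \<ge>
            (\<Sum>i = 1..n. expectation (\<lambda>\<omega>. g (X i \<omega>))) + real n * h / 2} \<in> sets P"
        by measurable
    qed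
    also have "\<dots> \<le> exp (-2 * (real n * h / 2)\<^sup>2 / (\<Sum>i\<in>{1..n}. (d - - d)\<^sup>2))"
      by (rule Hoeffding_ineq_ge) (use h n in \<open>auto simp: d_def\<close>)
    also have "-2 * (real n * h / 2)\<^sup>2 / (\<Sum>i\<in>{1..n}. (d - - d)\<^sup>2) = - (h\<^sup>2 / (8 * d\<^sup>2)) * real n"
      using n d by (simp add: field_simps power2_eq_square)
    finally show ?thesis .
  qed
  define a where "a = h\<^sup>2 / (8 * d\<^sup>2)"
  have a: "a > 0" using h by (simp add: a_def d_def)
  have lim: "(\<lambda>n. exp (- a * real n)) \<longlonglongrightarrow> 0"
  proof (rule filterlim_compose[OF exp_at_bot])
    show "LIM n sequentially. - a * real n :> at_bot"
      by (rule filterlim_tendsto_neg_mult_at_bot[OF tendsto_const])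
         (use a filterlim_real_sequentially in auto)
  qed
  show ?thesis
  proof (rule tendsto_sandwich[OF always_eventually _ tendsto_const lim])
    show "\<forall>\<^sub>F n in sequentially.
        measure P {\<omega> \<in> space P. (\<Sum>i = 1..n. g (X i \<omega>)) \<ge> - (real n * h / 2)} \<le> exp (- a * real n)"
      unfolding a_def by (rule eventually_sequentiallyI[OF bound])
  qed simp
qed

section \<open>Covariances of absolutely convergent series\<close>

lemma infsum_mult_pairs:
  fixes v w :: "'i \<Rightarrow> real"
  assumes "(\<lambda>i. \<bar>v i\<bar>) summable_on UNIV" "(\<lambda>i. \<bar>w i\<bar>) summable_on UNIV"
  shows "(\<lambda>(i, j). \<bar>v i\<bar> * \<bar>w j\<bar>) summable_on UNIV"
    and "(\<Sum>\<^sub>\<infinity>(i, j)\<in>UNIV. v i * w j) = (\<Sum>\<^sub>\<infinity>i. v i) * (\<Sum>\<^sub>\<infinity>j. w j)"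
proof -
  have abs: "Infinite_Sum.abs_summable_on (\<lambda>p. v (fst p) * w (snd p)) (UNIV \<times> UNIV)"
    unfolding Infinite_Sum.abs_summable_on_Sigma_iff using assms
    by (auto simp: abs_mult infsum_cmult_right' infsum_nonneg
             intro!: summable_on_cmult_right summable_on_cmult_left)
  then show "(\<lambda>(i, j). \<bar>v i\<bar> * \<bar>w j\<bar>) summable_on UNIV"
    by (simp add: abs_mult case_prod_unfold)
  have "(\<lambda>(i, j). v i * w j) summable_on (UNIV \<times> UNIV)"
    using abs_summable_summable[OF abs] by (simp add: case_prod_unfold)
  from infsum_Sigma'_banach[OF this] show
    "(\<Sum>\<^sub>\<infinity>(i, j)\<in>UNIV. v i * w j) = (\<Sum>\<^sub>\<infinity>i. v i) * (\<Sum>\<^sub>\<infinity>j. w j)"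
    by (simp add: infsum_cmult_right' infsum_cmult_left')
qed

lemma cov_abs_le:
  fixes f g :: "'a \<Rightarrow> real"
  assumes M: "prob_space M" and [measurable]: "f \<in> borel_measurable M" "g \<in> borel_measurable M"
    and f: "\<And>x. x \<in> space M \<Longrightarrow> \<bar>f x\<bar> \<le> c" and g: "\<And>x. x \<in> space M \<Longrightarrow> \<bar>g x\<bar> \<le> d"
  shows "\<And>x. x \<in> space M \<Longrightarrow> \<bar>f x - (\<integral>v. f v \<partial>M)\<bar> \<le> 2 * c"
    and "\<bar>cov M f g\<bar> \<le> 4 * c * d"
proof -
  interpret prob_space M by fact
  have dev: "\<bar>h x - (\<integral>v. h v \<partial>M)\<bar> \<le> 2 * k"
    if [measurable]: "h \<in> borel_measurable M" and h: "\<And>x. x \<in> space M \<Longrightarrow> \<bar>h x\<bar> \<le> k"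
      and x: "x \<in> space M" for h :: "'a \<Rightarrow> real" and k x
  proof -
    have i: "integrable M h"
      by (rule integrable_const_bound[where B = k]) (use h in auto)
    have "\<bar>\<integral>v. h v \<partial>M\<bar> \<le> (\<integral>v. \<bar>h v\<bar> \<partial>M)" by simp
    also have "\<dots> \<le> (\<integral>v. k \<partial>M)" using i h by (intro integral_mono) auto
    finally show ?thesis using h[OF x] by (simp add: prob_space)
  qed
  show "\<And>x. x \<in> space M \<Longrightarrow> \<bar>f x - (\<integral>v. f v \<partial>M)\<bar> \<le> 2 * c"
    by (rule dev[OF _ f]) auto
  have p: "\<bar>(f x - (\<integral>v. f v \<partial>M)) * (g x - (\<integral>v. g v \<partial>M))\<bar> \<le> 4 * c * d" if "x \<in> space M" for x
    using mult_mono[OF dev[OF _ f that] dev[OF _ g that]] f[OF that]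
    by (force simp: abs_mult)
  have i: "integrable M (\<lambda>x. (f x - (\<integral>v. f v \<partial>M)) * (g x - (\<integral>v. g v \<partial>M)))"
    by (rule integrable_const_bound[where B = "4 * c * d"]) (use p in auto)
  have "\<bar>cov M f g\<bar> \<le> (\<integral>x. \<bar>(f x - (\<integral>v. f v \<partial>M)) * (g x - (\<integral>v. g v \<partial>M))\<bar> \<partial>M)"
    unfolding cov_def by simp
  also have "\<dots> \<le> (\<integral>x. 4 * c * d \<partial>M)"
    using i p by (intro integral_mono) auto
  finally show "\<bar>cov M f g\<bar> \<le> 4 * c * d" by (simp add: prob_space)
qed

text \<open>Bilinearity of the covariance for infinite combinations. Each statistic is centred
  first; the square of the centred series is a double series dominated by
  \<open>\<bar>v l\<bar> * \<bar>v l'\<bar>\<close> up to a constant, so integral and sum may be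
  exchanged.\<close>

lemma cov_infsum:
  fixes v :: "'i::countable \<Rightarrow> real" and \<phi> :: "'i \<Rightarrow> 'a \<Rightarrow> real"
  assumes M: "prob_space M" and [measurable]: "\<And>l. \<phi> l \<in> borel_measurable M"
    and bnd: "\<And>l x. x \<in> space M \<Longrightarrow> \<bar>\<phi> l x\<bar> \<le> b" and v: "(\<lambda>l. \<bar>v l\<bar>) summable_on UNIV"
  shows "cov M (\<lambda>x. \<Sum>\<^sub>\<infinity>l. v l * \<phi> l x) (\<lambda>x. \<Sum>\<^sub>\<infinity>l. v l * \<phi> l x) =
           (\<Sum>\<^sub>\<infinity>(l, l')\<in>UNIV. v l * v l' * cov M (\<phi> l) (\<phi> l'))"
proof -
  interpret prob_space M by fact
  have b: "b \<ge> 0" using not_empty bnd abs_ge_zero order_trans by blast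
  have vb: "(\<lambda>l. \<bar>v l\<bar> * k) summable_on UNIV" for k
    using v by (rule summable_on_cmult_left)
  define m where "m l = (\<integral>x. \<phi> l x \<partial>M)" for l
  define \<psi> where "\<psi> l x = \<phi> l x - m l" for l x
  have [measurable]: "\<psi> l \<in> borel_measurable M" for l
    unfolding \<psi>_def[abs_def] by measurable
  have \<psi>: "\<bar>\<psi> l x\<bar> \<le> 2 * b" if "x \<in> space M" for l x
    unfolding \<psi>_def m_def by (rule cov_abs_le(1)[where g = "\<phi> l" and d = b, OF M _ _ bnd bnd that]) auto
  have v\<phi>: "\<bar>v l * \<phi> l x\<bar> \<le> \<bar>v l\<bar> * b" if "x \<in> space M" for l x
    using bnd[OF that] by (simp add: abs_mult mult_left_mono)
  have v\<psi>: "\<bar>v l * \<psi> l x\<bar> \<le> \<bar>v l\<bar> * (2 * b)" if "x \<in> space M" for l x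
    using \<psi>[OF that] unfolding abs_mult by (intro mult_left_mono) auto
  have sum\<psi>: "(\<lambda>l. v l * \<psi> l x) summable_on UNIV" "(\<lambda>l. \<bar>v l * \<psi> l x\<bar>) summable_on UNIV"
    if "x \<in> space M" for x
    by (rule abs_summable_reals_bounded[OF v\<psi>[OF that] vb])+
  have "(\<integral>x. (\<Sum>\<^sub>\<infinity>l. v l * \<phi> l x) \<partial>M) = (\<Sum>\<^sub>\<infinity>l. \<integral>x. v l * \<phi> l x \<partial>M)"
    by (rule integral_infsum_bounded[OF finite_measure_axioms _ v\<phi> vb]) auto
  also have "\<dots> = (\<Sum>\<^sub>\<infinity>l. v l * m l)"
    by (simp add: m_def)
  finally have mean: "(\<integral>x. (\<Sum>\<^sub>\<infinity>l. v l * \<phi> l x) \<partial>M) = (\<Sum>\<^sub>\<infinity>l. v l * m l)" .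
  have dev: "(\<Sum>\<^sub>\<infinity>l. v l * \<phi> l x) - (\<Sum>\<^sub>\<infinity>l. v l * m l) = (\<Sum>\<^sub>\<infinity>l. v l * \<psi> l x)"
    if x: "x \<in> space M" for x
  proof -
    have s\<phi>: "(\<lambda>l. v l * \<phi> l x) summable_on UNIV"
      by (rule abs_summable_reals_bounded(1)[OF v\<phi>[OF x] vb])
    have "(\<lambda>l. v l * \<phi> l x + - (v l * \<psi> l x)) summable_on UNIV"
      using s\<phi> sum\<psi>(1)[OF x] by (intro summable_on_add) (auto simp: summable_on_uminus)
    then have sm: "(\<lambda>l. v l * m l) summable_on UNIV"
      by (simp add: \<psi>_def algebra_simps)
    have "(\<Sum>\<^sub>\<infinity>l. v l * \<phi> l x) = (\<Sum>\<^sub>\<infinity>l. v l * \<psi> l x + v l * m l)"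
      by (simp add: \<psi>_def algebra_simps)
    also have "\<dots> = (\<Sum>\<^sub>\<infinity>l. v l * \<psi> l x) + (\<Sum>\<^sub>\<infinity>l. v l * m l)"
      by (rule infsum_add[OF sum\<psi>(1)[OF x] sm])
    finally show ?thesis by simp
  qed
  have "cov M (\<lambda>x. \<Sum>\<^sub>\<infinity>l. v l * \<phi> l x) (\<lambda>x. \<Sum>\<^sub>\<infinity>l. v l * \<phi> l x) =
      (\<integral>x. (\<Sum>\<^sub>\<infinity>l. v l * \<psi> l x) * (\<Sum>\<^sub>\<infinity>l. v l * \<psi> l x) \<partial>M)"
    unfolding cov_def mean by (intro Bochner_Integration.integral_cong) (auto simp: dev)
  also have "\<dots> = (\<integral>x. (\<Sum>\<^sub>\<infinity>p. v (fst p) * \<psi> (fst p) x * (v (snd p) * \<psi> (snd p) x)) \<partial>M)"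
    by (intro Bochner_Integration.integral_cong refl)
       (simp add: infsum_mult_pairs(2)[OF sum\<psi>(2) sum\<psi>(2), symmetric] case_prod_unfold)
  also have "\<dots> = (\<Sum>\<^sub>\<infinity>p. \<integral>x. v (fst p) * \<psi> (fst p) x * (v (snd p) * \<psi> (snd p) x) \<partial>M)"
  proof (rule integral_infsum_bounded[OF finite_measure_axioms])
    show "\<bar>v (fst p) * \<psi> (fst p) x * (v (snd p) * \<psi> (snd p) x)\<bar> \<le>
        \<bar>v (fst p)\<bar> * \<bar>v (snd p)\<bar> * (2 * b * (2 * b))" if "x \<in> space M" for p x
      using mult_mono[OF v\<psi>[OF that, of "fst p"] v\<psi>[OF that, of "snd p"]] b
      by (simp add: abs_mult ac_simps)
    show "(\<lambda>p. \<bar>v (fst p)\<bar> * \<bar>v (snd p)\<bar> * (2 * b * (2 * b))) summable_on UNIV"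
      using infsum_mult_pairs(1)[OF v v] by (intro summable_on_cmult_left) (simp add: case_prod_unfold)
  qed measurable
  also have "\<dots> = (\<Sum>\<^sub>\<infinity>(l, l')\<in>UNIV. v l * v l' * cov M (\<phi> l) (\<phi> l'))"
  proof (rule infsum_cong)
    fix p
    have "(\<integral>x. v (fst p) * \<psi> (fst p) x * (v (snd p) * \<psi> (snd p) x) \<partial>M) =
        (\<integral>x. (v (fst p) * v (snd p)) * (\<psi> (fst p) x * \<psi> (snd p) x) \<partial>M)"
      by (simp add: ac_simps)
    then show "(\<integral>x. v (fst p) * \<psi> (fst p) x * (v (snd p) * \<psi> (snd p) x) \<partial>M) =
        (case p of (l, l') \<Rightarrow> v l * v l' * cov M (\<phi> l) (\<phi> l'))"
      by (simp add: cov_def \<psi>_def m_def case_prod_unfold)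
  qed
  finally show ?thesis .
qed

section \<open>Matrices with summable rows\<close>

text \<open>No finiteness of \<open>G\<close> is asked for: a sum over an infinite set is 0 by
  convention.\<close>

lemma sum_le_infsum_nonneg:
  fixes f :: "'i \<Rightarrow> real"
  assumes "\<And>i. f i \<ge> 0" "f summable_on UNIV"
  shows "sum f G \<le> infsum f UNIV"
proof (cases "finite G")
  case True
  then show ?thesis
    using assms by (intro finite_sum_le_infsum) auto
next
  case False
  then show ?thesis using assms by (simp add: infsum_nonneg)
qed

text \<open>The diagonal entry is included, in contrast to the summability condition in
  \<open>sym_mats\<close>, because \<open>energy\<close> below treats the self-interaction as one
  more term of the series.\<close>

definition row_norm :: "('s \<Rightarrow> 's \<Rightarrow> real) \<Rightarrow> 's \<Rightarrow> real" where
  "row_norm \<Delta> s = (\<Sum>\<^sub>\<infinity>l. \<bar>\<Delta> s l\<bar>)"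

definition row_summable :: "('s \<Rightarrow> 's \<Rightarrow> real) \<Rightarrow> 's \<Rightarrow> bool" where
  "row_summable \<theta> s \<longleftrightarrow> (\<lambda>l. \<bar>\<theta> s l\<bar>) summable_on UNIV"

lemma row_norm_nonneg: "0 \<le> row_norm \<Delta> s"
  unfolding row_norm_def by (rule infsum_nonneg) simp

lemma row_norm_minus_commute: "row_norm (\<theta> - \<eta>) s = row_norm (\<eta> - \<theta>) s"
  by (simp add: row_norm_def abs_minus_commute)

lemma row_summable_add:
  assumes "row_summable \<theta> s" "row_summable \<eta> s"
  shows "row_summable (\<theta> + \<eta>) s"
  unfolding row_summable_def
  by (rule summable_on_comparison_test[where f = "\<lambda>l. \<bar>\<theta> s l\<bar> + \<bar>\<eta> s l\<bar>"])
     (use assms in \<open>auto simp: row_summable_def intro: summable_on_add\<close>)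

lemma row_summable_diff:
  assumes "row_summable \<theta> s" "row_summable \<eta> s"
  shows "row_summable (\<theta> - \<eta>) s"
  unfolding row_summable_def
  by (rule summable_on_comparison_test[where f = "\<lambda>l. \<bar>\<theta> s l\<bar> + \<bar>\<eta> s l\<bar>"])
     (use assms in \<open>auto simp: row_summable_def intro: summable_on_add\<close>)

lemma row_norm_triangle:
  assumes "row_summable \<theta> s" "row_summable \<eta> s"
  shows "row_norm (\<theta> + \<eta>) s \<le> row_norm \<theta> s + row_norm \<eta> s"
proof -
  have "row_norm (\<theta> + \<eta>) s \<le> (\<Sum>\<^sub>\<infinity>l. \<bar>\<theta> s l\<bar> + \<bar>\<eta> s l\<bar>)"
    unfolding row_norm_def using row_summable_add[OF assms] assms
    by (intro infsum_mono summable_on_add) (auto simp: row_summable_def)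
  also have "\<dots> = row_norm \<theta> s + row_norm \<eta> s"
    unfolding row_norm_def by (rule infsum_add) (use assms in \<open>auto simp: row_summable_def\<close>)
  finally show ?thesis .
qed

lemma sym_mats_row_summable:
  assumes "\<theta> \<in> sym_mats"
  shows "row_summable \<theta> s"
proof -
  have "\<forall>s. (\<lambda>l. \<bar>\<theta> s l\<bar>) summable_on (UNIV - {s})"
    using assms unfolding sym_mats_def by blast
  then have "(\<lambda>l. \<bar>\<theta> s l\<bar>) summable_on (insert s (UNIV - {s}))"
    unfolding summable_on_insert_iff by blast
  then show ?thesis by (simp add: insert_absorb row_summable_def)
qed

text \<open>\<open>norm1\<close> sees one triangle including the diagonal. By symmetry the swapped
  triangle has the same mass and the two cover all pairs, whence the factor 2.\<close>

lemma sym_mats1_entries: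
  fixes \<Delta> :: "'s::linorder \<Rightarrow> 's \<Rightarrow> real"
  assumes "\<Delta> \<in> sym_mats1"
  shows "(\<lambda>(s, l). \<bar>\<Delta> s l\<bar>) summable_on UNIV"
    and "(\<Sum>\<^sub>\<infinity>(s, l)\<in>UNIV. \<bar>\<Delta> s l\<bar>) \<le> 2 * norm1 \<Delta>"
proof -
  let ?L = "lower_pairs (UNIV :: 's set)" and ?f = "\<lambda>(s, l). \<bar>\<Delta> s l\<bar>"
  have sym: "\<Delta> s l = \<Delta> l s" for s l
    using assms unfolding sym_mats1_def sym_mats_def by blast
  have L: "?f summable_on ?L"
    using assms by (simp add: sym_mats1_def)
  have fs: "?f \<circ> prod.swap = ?f"
    using sym by (auto simp: fun_eq_iff)
  have inj: "inj_on prod.swap ?L" by (auto simp: inj_on_def)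
  have L': "?f summable_on prod.swap ` ?L"
    using L fs summable_on_reindex[OF inj, of ?f] by simp
  have eqL': "infsum ?f (prod.swap ` ?L) = norm1 \<Delta>"
    using infsum_reindex[OF inj, of ?f] fs by (simp add: norm1_def)
  \<comment> \<open>Removing \<open>?L\<close> from its mirror image makes the union disjoint; the
    overlap is the diagonal.\<close>
  have U: "UNIV = ?L \<union> (prod.swap ` ?L - ?L)"
  proof -
    have "p \<in> ?L \<union> prod.swap ` ?L" for p :: "'s \<times> 's"
      using linear[of "fst p" "snd p"]
      by (cases p) (auto simp: lower_pairs_def image_iff prod.swap_def)
    then show ?thesis by auto
  qed
  have D: "?f summable_on (prod.swap ` ?L - ?L)"
    by (rule summable_on_subset_banach[OF L']) auto
  show "?f summable_on UNIV"
    by (subst U) (rule summable_on_Un_disjoint[OF L D], auto)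
  have "infsum ?f UNIV = infsum ?f ?L + infsum ?f (prod.swap ` ?L - ?L)"
    by (subst U) (rule infsum_Un_disjoint[OF L D], auto)
  also have "infsum ?f (prod.swap ` ?L - ?L) \<le> infsum ?f (prod.swap ` ?L)"
    by (rule infsum_mono_neutral[OF D L']) auto
  finally show "infsum ?f UNIV \<le> 2 * norm1 \<Delta>"
    using eqL' by (simp add: norm1_def)
qed

lemma row_norm_summable:
  fixes \<Delta> :: "'s::linorder \<Rightarrow> 's \<Rightarrow> real"
  assumes "\<Delta> \<in> sym_mats1"
  shows "row_norm \<Delta> summable_on UNIV" and "infsum (row_norm \<Delta>) UNIV \<le> 2 * norm1 \<Delta>"
proof -
  have *: "(\<lambda>(s, l). \<bar>\<Delta> s l\<bar>) summable_on (SIGMA s:UNIV. UNIV)"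
    using sym_mats1_entries(1)[OF assms] by simp
  show "row_norm \<Delta> summable_on UNIV"
    unfolding row_norm_def[abs_def] using summable_on_Sigma_banach[OF *] by simp
  show "infsum (row_norm \<Delta>) UNIV \<le> 2 * norm1 \<Delta>"
    unfolding row_norm_def[abs_def] using infsum_Sigma'_banach[OF *] sym_mats1_entries(2)[OF assms]
    by simp
qed

lemma sum_row_norm_le:
  fixes \<Delta> :: "'s::linorder \<Rightarrow> 's \<Rightarrow> real"
  assumes "\<Delta> \<in> sym_mats1"
  shows "sum (row_norm \<Delta>) G \<le> 2 * norm1 \<Delta>"
  using sum_le_infsum_nonneg[OF row_norm_nonneg row_norm_summable(1)[OF assms]]
    row_norm_summable(2)[OF assms] by (rule order_trans)

text \<open>Applied to the row norms of a fixed matrix, this selects the finitely many sites that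
  must be treated by the law of large numbers.\<close>

lemma summable_tail_real:
  fixes f :: "'i \<Rightarrow> real"
  assumes nn: "\<And>i. f i \<ge> 0" and f: "f summable_on UNIV" and e: "e > 0"
  obtains F where "finite F" "\<And>G. finite G \<Longrightarrow> G \<inter> F = {} \<Longrightarrow> sum f G \<le> e"
proof -
  obtain F where F: "finite F" "dist (sum f F) (infsum f UNIV) \<le> e"
    using infsum_finite_approximation[OF f e] by auto
  have "sum f G \<le> e" if "finite G" "G \<inter> F = {}" for G
  proof -
    have "sum f F + sum f G = sum f (F \<union> G)"
      using F that by (subst sum.union_disjoint) auto
    also have "\<dots> \<le> infsum f UNIV" by (rule sum_le_infsum_nonneg[OF nn f])
    finally show ?thesis using F(2) by (simp add: dist_real_def)
  qed
  with F(1) show ?thesis using that by blast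
qed

lemma sym_mats1_diff:
  fixes \<theta> :: "'s::linorder \<Rightarrow> 's \<Rightarrow> real"
  assumes "\<theta> \<in> sym_mats1" "\<eta> \<in> sym_mats1"
  shows "\<theta> - \<eta> \<in> sym_mats1"
proof -
  have "(\<lambda>(s, l). \<bar>(\<theta> - \<eta>) s l\<bar>) summable_on lower_pairs UNIV"
  proof -
    have "(\<lambda>p. (case p of (s, l) \<Rightarrow> \<bar>\<theta> s l\<bar>) + (case p of (s, l) \<Rightarrow> \<bar>\<eta> s l\<bar>))
            summable_on lower_pairs UNIV"
      using assms by (intro summable_on_add) (auto simp: sym_mats1_def)
    then show ?thesis
      by (rule summable_on_comparison_test) auto
  qed
  moreover have "(\<lambda>l. \<bar>(\<theta> - \<eta>) s l\<bar>) summable_on (UNIV - {s})" for s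
  proof -
    have "(\<lambda>l. \<bar>\<theta> s l\<bar> + \<bar>\<eta> s l\<bar>) summable_on (UNIV - {s})"
      using assms by (intro summable_on_add) (auto simp: sym_mats1_def sym_mats_def)
    then show ?thesis
      by (rule summable_on_comparison_test) auto
  qed
  moreover have "(\<theta> - \<eta>) s l = (\<theta> - \<eta>) l s" for s l
  proof -
    have "\<theta> s l = \<theta> l s" "\<eta> s l = \<eta> l s"
      using assms unfolding sym_mats1_def sym_mats_def by blast+
    then show ?thesis by simp
  qed
  ultimately show ?thesis
    unfolding sym_mats1_def sym_mats_def by blast
qed

lemma sum_entries_le_norm1:
  fixes \<Delta> :: "'s::linorder \<Rightarrow> 's \<Rightarrow> real"
  assumes "\<Delta> \<in> sym_mats1" "finite \<Lambda>"
  shows "(\<Sum>(s, l)\<in>lower_pairs \<Lambda>. \<bar>\<Delta> s l\<bar>) \<le> norm1 \<Delta>"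
proof -
  have "finite (lower_pairs \<Lambda>)"
    by (rule finite_subset[of _ "\<Lambda> \<times> \<Lambda>"]) (use assms in \<open>auto simp: lower_pairs_def\<close>)
  then show ?thesis
    unfolding norm1_def using assms
    by (intro finite_sum_le_infsum) (auto simp: sym_mats1_def lower_pairs_def)
qed

lemma fin_mats_row_summable:
  assumes "finite \<Lambda>" "\<theta> \<in> fin_mats \<Lambda>"
  shows "row_summable \<theta> s"
proof -
  have "(\<lambda>l. \<bar>\<theta> s l\<bar>) summable_on \<Lambda> \<longleftrightarrow> (\<lambda>l. \<bar>\<theta> s l\<bar>) summable_on UNIV"
    by (rule summable_on_cong_neutral) (use assms(2) in \<open>auto simp: fin_mats_def\<close>)
  then show ?thesis
    using assms(1) by (simp add: row_summable_def)
qed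

lemma truncate_in_fin_mats:
  assumes "\<theta> \<in> sym_mats"
  shows "truncate \<Lambda> \<theta> \<in> fin_mats \<Lambda>"
proof -
  have "\<theta> s l = \<theta> l s" for s l
    using assms unfolding sym_mats_def by blast
  then show ?thesis
    by (auto simp: fin_mats_def truncate_def)
qed

lemma Argmax_ge:
  assumes "\<theta> \<in> Argmax T Q" "\<eta> \<in> T"
  shows "Q \<eta> \<le> Q \<theta>"
proof -
  have "ereal (Q \<eta>) \<le> (SUP \<eta>\<in>T. ereal (Q \<eta>))"
    using assms(2) by (rule SUP_upper)
  also have "\<dots> = ereal (Q \<theta>)"
    using assms(1) by (simp add: Argmax_def)
  finally show ?thesis by simp
qed

text \<open>The whole influence of the penalty on the consistency proof is this bound, used with
  \<open>L = C * lam n\<close>, which is of smaller order than \<open>n\<close>.\<close>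

lemma penalty_diff_le:
  fixes \<theta> \<eta> :: "'s::linorder \<Rightarrow> 's \<Rightarrow> real"
  assumes lip: "\<And>x y :: real. \<bar>p \<bar>y\<bar> - p \<bar>x\<bar>\<bar> \<le> L * \<bar>y - x\<bar>" and L: "L \<ge> 0"
    and d: "\<theta> - \<eta> \<in> sym_mats1" and fin: "finite \<Lambda>"
  shows "(\<Sum>(s, l)\<in>lower_pairs \<Lambda>. p \<bar>\<eta> s l\<bar>) - (\<Sum>(s, l)\<in>lower_pairs \<Lambda>. p \<bar>\<theta> s l\<bar>)
           \<le> L * norm1 (\<theta> - \<eta>)"
proof -
  have "(\<Sum>(s, l)\<in>lower_pairs \<Lambda>. p \<bar>\<eta> s l\<bar>) - (\<Sum>(s, l)\<in>lower_pairs \<Lambda>. p \<bar>\<theta> s l\<bar>) =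
      (\<Sum>(s, l)\<in>lower_pairs \<Lambda>. p \<bar>\<eta> s l\<bar> - p \<bar>\<theta> s l\<bar>)"
    by (simp add: sum_subtractf case_prod_unfold)
  also have "\<dots> \<le> (\<Sum>(s, l)\<in>lower_pairs \<Lambda>. L * \<bar>(\<theta> - \<eta>) s l\<bar>)"
  proof (rule sum_mono)
    fix x :: "'s \<times> 's"
    show "(case x of (s, l) \<Rightarrow> p \<bar>\<eta> s l\<bar> - p \<bar>\<theta> s l\<bar>) \<le> (case x of (s, l) \<Rightarrow> L * \<bar>(\<theta> - \<eta>) s l\<bar>)"
      using lip[of "\<eta> (fst x) (snd x)" "\<theta> (fst x) (snd x)"]
      by (simp add: case_prod_unfold abs_minus_commute)
  qed
  also have "\<dots> = L * (\<Sum>(s, l)\<in>lower_pairs \<Lambda>. \<bar>(\<theta> - \<eta>) s l\<bar>)"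
    by (simp add: sum_distrib_left case_prod_unfold)
  also have "\<dots> \<le> L * norm1 (\<theta> - \<eta>)"
    by (rule mult_left_mono[OF sum_entries_le_norm1[OF d fin] L])
  finally show ?thesis .
qed

lemma finite_subset_increasing_union:
  assumes mono: "mono_on {1..} D" and un: "(\<Union>n\<in>{1..}. D n) = UNIV" and W: "finite W"
  obtains N where "N \<ge> (1::nat)" "\<And>n. n \<ge> N \<Longrightarrow> W \<subseteq> D n"
proof -
  have "\<exists>N\<ge>1. \<forall>n\<ge>N. W \<subseteq> D n"
    using W
  proof induction
    case (insert w W)
    then obtain N where N: "N \<ge> 1" "\<forall>n\<ge>N. W \<subseteq> D n" by blast
    have "w \<in> (\<Union>n\<in>{1..}. D n)" using un by simp
    then obtain m where m: "m \<ge> 1" "w \<in> D m" by auto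
    have "w \<in> D n" if "n \<ge> m" for n
      using mono_onD[OF mono, of m n] m that by auto
    then show ?case
      using N by (intro exI[of _ "max N m"]) auto
  qed auto
  then show ?thesis using that by blast
qed

section \<open>Conditional densities and expected log likelihood ratios\<close>

text \<open>The constants \<open>a\<close> and \<open>b\<close> bound \<open>A\<close> and
  \<open>B\<close> on the state space. The bound \<open>b\<close> enters all Lipschitz estimates;
  \<open>a\<close> is needed for integrability and positivity of the weights and cancels in
  likelihood ratios.\<close>

locale cond_field = finite_measure \<rho>
  for \<rho> :: "'x measure" +
  fixes A B0 :: "'x \<Rightarrow> real" and B :: "'x \<Rightarrow> 'x \<Rightarrow> real"
    and \<theta>star :: "'s::countable \<Rightarrow> 's \<Rightarrow> real" and \<mu> :: "('s \<Rightarrow> 'x) measure" and a b :: real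
  assumes rho_pos: "emeasure \<rho> (space \<rho>) \<noteq> 0"
    and A_meas[measurable]: "A \<in> borel_measurable \<rho>"
    and B_meas: "(\<lambda>(x, y). B x y) \<in> borel_measurable (\<rho> \<Otimes>\<^sub>M \<rho>)"
    and A_le: "\<And>u. u \<in> space \<rho> \<Longrightarrow> \<bar>A u\<bar> \<le> a"
    and B_le: "\<And>u v. u \<in> space \<rho> \<Longrightarrow> v \<in> space \<rho> \<Longrightarrow> \<bar>B u v\<bar> \<le> b"
    and B_diag: "\<And>u. u \<in> space \<rho> \<Longrightarrow> B u u = B0 u"
    and star_row: "\<And>s. row_summable \<theta>star s"
    and law: "field_law \<rho> A B0 B \<theta>star \<mu>"
begin

lemma sets_mu[measurable_cong]: "sets \<mu> = sets (\<Pi>\<^sub>M l\<in>UNIV. \<rho>)"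
  using law by (simp add: field_law_def)

lemma space_mu: "space \<mu> = UNIV \<rightarrow>\<^sub>E space \<rho>"
  using sets_eq_imp_space_eq[OF sets_mu] by (simp add: space_PiM)

lemma in_space_mu: "x \<in> space \<mu> \<Longrightarrow> x l \<in> space \<rho>"
  unfolding space_mu by auto

sublocale mu: prob_space \<mu>
  using law by (simp add: field_law_def)

lemma upd_space: "x \<in> space \<mu> \<Longrightarrow> u \<in> space \<rho> \<Longrightarrow> (x(s := u)) l \<in> space \<rho>"
  using in_space_mu by auto

lemma upd_in_space_mu: "x \<in> space \<mu> \<Longrightarrow> u \<in> space \<rho> \<Longrightarrow> x(s := u) \<in> space \<mu>"
  unfolding space_mu by auto

lemma upd_meas[measurable]: "(\<lambda>(x, u). x(s := u)) \<in> measurable (\<mu> \<Otimes>\<^sub>M \<rho>) \<mu>"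
proof -
  have "(\<lambda>p. (fst p)(s := snd p)) \<in> measurable (\<mu> \<Otimes>\<^sub>M \<rho>) (\<Pi>\<^sub>M l\<in>UNIV. \<rho>)"
    by (rule measurable_PiM_single') (auto simp: space_pair_measure space_mu)
  then show ?thesis
    by (simp add: case_prod_unfold measurable_cong_sets[OF refl sets_mu])
qed

lemma stat_meas[measurable]:
  "(\<lambda>(x, u). B u ((x(s := u)) l)) \<in> borel_measurable (\<mu> \<Otimes>\<^sub>M \<rho>)"
proof -
  have "(\<lambda>p. (fst p)(s := snd p)) \<in> measurable (\<mu> \<Otimes>\<^sub>M \<rho>) (\<Pi>\<^sub>M l\<in>UNIV. \<rho>)"
    using upd_meas by (simp add: case_prod_unfold measurable_cong_sets[OF refl sets_mu])
  then have [measurable]: "(\<lambda>p. ((fst p)(s := snd p)) l) \<in> measurable (\<mu> \<Otimes>\<^sub>M \<rho>) \<rho>"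
    by (rule measurable_compose[OF _ measurable_component_singleton]) simp
  have "(\<lambda>p. (snd p, ((fst p)(s := snd p)) l)) \<in> measurable (\<mu> \<Otimes>\<^sub>M \<rho>) (\<rho> \<Otimes>\<^sub>M \<rho>)"
    by measurable
  from measurable_compose[OF this B_meas] show ?thesis
    by (simp add: case_prod_unfold)
qed

text \<open>With the configuration updated to \<open>x(s := u)\<close> the term \<open>l = s\<close>
  is \<open>B u u\<close>, that is \<open>B0 u\<close>. Self-interaction and pair interactions thus
  form one series, linear in row \<open>s\<close>, whose statistics are those of
  \<open>cov_matrix\<close>.\<close>

definition energy :: "('s \<Rightarrow> 's \<Rightarrow> real) \<Rightarrow> 's \<Rightarrow> ('s \<Rightarrow> 'x) \<Rightarrow> 'x \<Rightarrow> real" where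
  "energy \<theta> s x u = (\<Sum>\<^sub>\<infinity>l. \<theta> s l * B u ((x(s := u)) l))"

lemma space_rho_nonempty: "space \<rho> \<noteq> {}"
  using rho_pos by auto

lemma b_nonneg: "b \<ge> 0"
  using space_rho_nonempty B_le abs_ge_zero order_trans by blast

lemma energy_term_le:
  assumes "x \<in> space \<mu>" "u \<in> space \<rho>"
  shows "\<bar>\<theta> s l * B u ((x(s := u)) l)\<bar> \<le> b * \<bar>\<theta> s l\<bar>"
  using mult_right_mono[OF B_le[OF assms(2) upd_space[OF assms, of s l]], of "\<bar>\<theta> s l\<bar>"]
  by (simp add: abs_mult mult.commute)

lemma weighted_row_summable:
  assumes "row_summable \<theta> s"
  shows "(\<lambda>l. b * \<bar>\<theta> s l\<bar>) summable_on UNIV"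
  using assms unfolding row_summable_def by (rule summable_on_cmult_right)

lemma energy_summable:
  assumes "row_summable \<theta> s" "x \<in> space \<mu>" "u \<in> space \<rho>"
  shows "(\<lambda>l. \<theta> s l * B u ((x(s := u)) l)) summable_on UNIV"
  by (rule abs_summable_reals_bounded(1)[OF _ weighted_row_summable[OF assms(1)]])
     (rule energy_term_le[OF assms(2,3)])

lemma energy_meas[measurable]:
  assumes "row_summable \<theta> s"
  shows "(\<lambda>(x, u). energy \<theta> s x u) \<in> borel_measurable (\<mu> \<Otimes>\<^sub>M \<rho>)"
proof -
  have [measurable]: "(\<lambda>p. B (snd p) (((fst p)(s := snd p)) l)) \<in> borel_measurable (\<mu> \<Otimes>\<^sub>M \<rho>)" for l
    using stat_meas[of s l] by (simp add: case_prod_unfold)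
  show ?thesis
    unfolding energy_def case_prod_unfold
  proof (rule borel_measurable_infsum_bounded)
    show "\<bar>\<theta> s l * B (snd p) (((fst p)(s := snd p)) l)\<bar> \<le> b * \<bar>\<theta> s l\<bar>"
      if "p \<in> space (\<mu> \<Otimes>\<^sub>M \<rho>)" for l p
      by (rule energy_term_le) (use that in \<open>auto simp: space_pair_measure\<close>)
  qed (measurable, rule weighted_row_summable[OF assms])
qed

lemma energy_meas_u[measurable]:
  assumes "row_summable \<theta> s" "x \<in> space \<mu>"
  shows "energy \<theta> s x \<in> borel_measurable \<rho>"
  using measurable_Pair2[OF energy_meas[OF assms(1)] assms(2)] by simp

lemma energy_le:
  assumes "row_summable \<theta> s" "x \<in> space \<mu>" "u \<in> space \<rho>"
  shows "\<bar>energy \<theta> s x u\<bar> \<le> b * row_norm \<theta> s"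
proof -
  have s: "(\<lambda>l. b * \<bar>\<theta> s l\<bar>) summable_on UNIV"
    by (rule weighted_row_summable[OF assms(1)])
  have abs: "(\<lambda>l. \<bar>\<theta> s l * B u ((x(s := u)) l)\<bar>) summable_on UNIV"
    by (rule abs_summable_reals_bounded(2)[OF _ s]) (rule energy_term_le[OF assms(2,3)])
  have "\<bar>energy \<theta> s x u\<bar> \<le> (\<Sum>\<^sub>\<infinity>l. \<bar>\<theta> s l * B u ((x(s := u)) l)\<bar>)"
    unfolding energy_def using norm_infsum_bound[of "\<lambda>l. \<theta> s l * B u ((x(s := u)) l)" UNIV] abs
    by simp
  also have "\<dots> \<le> (\<Sum>\<^sub>\<infinity>l. b * \<bar>\<theta> s l\<bar>)"
    by (rule infsum_mono[OF abs s]) (rule energy_term_le[OF assms(2,3)])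
  also have "\<dots> = b * row_norm \<theta> s"
    unfolding row_norm_def using assms(1) by (intro infsum_cmult_right) (auto simp: row_summable_def)
  finally show ?thesis .
qed

lemma energy_diff:
  assumes "row_summable \<theta> s" "row_summable \<eta> s" "x \<in> space \<mu>" "u \<in> space \<rho>"
  shows "energy (\<theta> - \<eta>) s x u = energy \<theta> s x u - energy \<eta> s x u"
proof -
  have "energy \<theta> s x u = (\<Sum>\<^sub>\<infinity>l. (\<theta> - \<eta>) s l * B u ((x(s := u)) l) + \<eta> s l * B u ((x(s := u)) l))"
    unfolding energy_def by (rule infsum_cong) (simp add: algebra_simps)
  also have "\<dots> = energy (\<theta> - \<eta>) s x u + energy \<eta> s x u"
    unfolding energy_def
    by (intro infsum_add energy_summable row_summable_diff assms)
  finally show ?thesis by simp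
qed

lemma energy_upd [simp]: "energy \<theta> s (x(s := w)) u = energy \<theta> s x u"
  by (simp add: energy_def)

text \<open>Splitting off the term \<open>l = s\<close> recovers the separate \<open>B0\<close> term
  of \<open>cond_weight\<close>; at the other sites the update is invisible.\<close>

lemma cond_weight_energy:
  assumes "row_summable \<theta> s" "x \<in> space \<mu>" "u \<in> space \<rho>"
  shows "cond_weight A B0 B \<theta> (UNIV - {s}) s x u = exp (A u + energy \<theta> s x u)"
proof -
  let ?g = "\<lambda>l. \<theta> s l * B u ((x(s := u)) l)"
  have sm: "?g summable_on (UNIV - {s})"
    by (rule summable_on_subset_banach[OF energy_summable[OF assms]]) simp
  have "energy \<theta> s x u = infsum ?g (insert s (UNIV - {s}))"
    by (simp add: energy_def insert_absorb)
  also have "\<dots> = ?g s + infsum ?g (UNIV - {s})"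
    by (rule infsum_insert[OF sm]) simp
  also have "infsum ?g (UNIV - {s}) = (\<Sum>\<^sub>\<infinity>l\<in>UNIV - {s}. \<theta> s l * B u (x l))"
    by (rule infsum_cong) auto
  finally show ?thesis
    using B_diag[OF assms(3)] by (simp add: cond_weight_def add.assoc)
qed

definition Z :: "('s \<Rightarrow> 's \<Rightarrow> real) \<Rightarrow> 's \<Rightarrow> ('s \<Rightarrow> 'x) \<Rightarrow> real" where
  "Z \<theta> s x = (\<integral>w. exp (A w + energy \<theta> s x w) \<partial>\<rho>)"

lemma full_cond_density_eq:
  assumes "row_summable \<theta> s" "x \<in> space \<mu>" "u \<in> space \<rho>"
  shows "full_cond_density \<rho> A B0 B \<theta> s x u = exp (A u + energy \<theta> s x u) / Z \<theta> s x"
proof -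
  have "(\<integral>w. cond_weight A B0 B \<theta> (UNIV - {s}) s x w \<partial>\<rho>) = Z \<theta> s x"
    unfolding Z_def using assms by (intro Bochner_Integration.integral_cong cond_weight_energy) auto
  then show ?thesis
    using assms by (simp add: cond_density_def cond_weight_energy)
qed

lemma weight_le:
  assumes "row_summable \<theta> s" "x \<in> space \<mu>" "u \<in> space \<rho>"
  shows "exp (A u + energy \<theta> s x u) \<le> exp (a + b * row_norm \<theta> s)"
    and "exp (- (a + b * row_norm \<theta> s)) \<le> exp (A u + energy \<theta> s x u)"
  using A_le[OF assms(3)] energy_le[OF assms] by (auto simp: abs_le_iff)

lemma weight_integrable:
  assumes "row_summable \<theta> s" "x \<in> space \<mu>"
  shows "integrable \<rho> (\<lambda>u. exp (A u + energy \<theta> s x u))"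
  by (rule integrable_const_bound[where B = "exp (a + b * row_norm \<theta> s)"])
     (use assms weight_le in auto)

lemma measure_rho_pos: "measure \<rho> (space \<rho>) > 0"
  using rho_pos by (simp add: emeasure_eq_measure zero_less_measure_iff)

text \<open>The weights are bounded below by a positive constant and \<open>\<rho>\<close> has
  positive mass; this justifies all later logarithms and divisions.\<close>

lemma Z_pos:
  assumes "row_summable \<theta> s" "x \<in> space \<mu>"
  shows "Z \<theta> s x > 0"
proof -
  have "0 < exp (- (a + b * row_norm \<theta> s)) * measure \<rho> (space \<rho>)"
    using measure_rho_pos by simp
  also have "\<dots> = (\<integral>u. exp (- (a + b * row_norm \<theta> s)) \<partial>\<rho>)" by simp
  also have "\<dots> \<le> Z \<theta> s x"
    unfolding Z_def using assms weight_le
    by (intro integral_mono weight_integrable) auto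
  finally show ?thesis .
qed

lemma Z_meas[measurable]:
  assumes [simp]: "row_summable \<theta> s"
  shows "Z \<theta> s \<in> borel_measurable \<mu>"
  unfolding Z_def[abs_def] by measurable

section \<open>Log likelihoods and their Lipschitz dependence on the matrix\<close>

definition loglik :: "('s \<Rightarrow> 's \<Rightarrow> real) \<Rightarrow> 's \<Rightarrow> ('s \<Rightarrow> 'x) \<Rightarrow> real" where
  "loglik \<theta> s x = ln (full_cond_density \<rho> A B0 B \<theta> s x (x s))"

lemma loglik_eq:
  assumes "row_summable \<theta> s" "x \<in> space \<mu>"
  shows "loglik \<theta> s x = A (x s) + energy \<theta> s x (x s) - ln (Z \<theta> s x)"
  using assms Z_pos[OF assms] unfolding loglik_def
  by (subst full_cond_density_eq) (auto simp: in_space_mu ln_div)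

text \<open>Passing from \<open>\<eta>\<close> to \<open>\<theta>\<close> multiplies the integrand
  by at most \<open>exp (b * row_norm (\<theta> - \<eta>) s)\<close>, uniformly in the
  state.\<close>

lemma ln_Z_le:
  assumes "row_summable \<theta> s" "row_summable \<eta> s" "x \<in> space \<mu>"
  shows "ln (Z \<theta> s x) \<le> b * row_norm (\<theta> - \<eta>) s + ln (Z \<eta> s x)"
proof -
  let ?d = "b * row_norm (\<theta> - \<eta>) s"
  have "Z \<theta> s x \<le> (\<integral>u. exp ?d * exp (A u + energy \<eta> s x u) \<partial>\<rho>)"
    unfolding Z_def
  proof (intro integral_mono weight_integrable integrable_mult_right assms)
    fix u assume u: "u \<in> space \<rho>"
    have "energy \<theta> s x u \<le> energy \<eta> s x u + ?d"
      using energy_le[OF row_summable_diff[OF assms(1,2)] assms(3) u] energy_diff[OF assms u]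
      by (simp add: abs_le_iff)
    then show "exp (A u + energy \<theta> s x u) \<le> exp ?d * exp (A u + energy \<eta> s x u)"
      by (simp add: mult_exp_exp)
  qed
  also have "\<dots> = exp ?d * Z \<eta> s x" by (simp add: Z_def)
  finally have "ln (Z \<theta> s x) \<le> ln (exp ?d * Z \<eta> s x)"
    using Z_pos assms by (subst ln_le_cancel_iff) auto
  then show ?thesis
    using Z_pos[OF assms(2,3)] by (simp add: ln_mult)
qed

text \<open>One multiple of \<open>b\<close> comes from the energy at the observed state, the other
  from the log normalizing constant. The bound holds at every configuration and needs no
  expectation.\<close>

lemma loglik_lipschitz:
  assumes "row_summable \<theta> s" "row_summable \<eta> s" "x \<in> space \<mu>"
  shows "\<bar>loglik \<theta> s x - loglik \<eta> s x\<bar> \<le> 2 * b * row_norm (\<theta> - \<eta>) s"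
proof -
  have "\<bar>energy \<theta> s x (x s) - energy \<eta> s x (x s)\<bar> \<le> b * row_norm (\<theta> - \<eta>) s"
    using energy_le[OF row_summable_diff[OF assms(1,2)] assms(3) in_space_mu[OF assms(3), of s]]
      energy_diff[OF assms in_space_mu[OF assms(3), of s]]
    by simp
  moreover have "\<bar>ln (Z \<theta> s x) - ln (Z \<eta> s x)\<bar> \<le> b * row_norm (\<theta> - \<eta>) s"
    using ln_Z_le[OF assms] ln_Z_le[OF assms(2,1,3), unfolded row_norm_minus_commute[of \<eta> \<theta>]]
    by linarith
  ultimately show ?thesis
    using loglik_eq[OF assms(1,3)] loglik_eq[OF assms(2,3)] by linarith
qed

lemma energy_self_meas:
  assumes "row_summable \<theta> s"
  shows "(\<lambda>x. energy \<theta> s x (x s)) \<in> borel_measurable \<mu>"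
proof -
  have "(\<lambda>x. x s) \<in> measurable \<mu> \<rho>"
    by (simp add: measurable_cong_sets[OF sets_mu refl])
  then have "(\<lambda>x. (x, x s)) \<in> measurable \<mu> (\<mu> \<Otimes>\<^sub>M \<rho>)"
    by measurable
  from measurable_compose[OF this energy_meas[OF assms]] show ?thesis by simp
qed

definition gain :: "('s \<Rightarrow> 's \<Rightarrow> real) \<Rightarrow> 's \<Rightarrow> ('s \<Rightarrow> 'x) \<Rightarrow> real" where
  "gain \<Delta> s x = loglik (\<theta>star + \<Delta>) s x - loglik \<theta>star s x"

lemma gain_eq:
  assumes "row_summable \<Delta> s" "x \<in> space \<mu>"
  shows "gain \<Delta> s x = energy \<Delta> s x (x s) - (ln (Z (\<theta>star + \<Delta>) s x) - ln (Z \<theta>star s x))"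
  using loglik_eq[OF row_summable_add[OF star_row assms(1)] assms(2)] loglik_eq[OF star_row assms(2)]
    energy_diff[OF row_summable_add[OF star_row assms(1)] star_row assms(2) in_space_mu[OF assms(2)]]
  by (simp add: gain_def)

lemma gain_meas:
  assumes "row_summable \<Delta> s"
  shows "gain \<Delta> s \<in> borel_measurable \<mu>"
proof -
  note [measurable] = energy_self_meas[OF assms] Z_meas[OF star_row]
    Z_meas[OF row_summable_add[OF star_row assms]]
  have "(\<lambda>x. energy \<Delta> s x (x s) - (ln (Z (\<theta>star + \<Delta>) s x) - ln (Z \<theta>star s x)))
          \<in> borel_measurable \<mu>"
    by measurable
  then show ?thesis
    using gain_eq[OF assms] by (simp cong: measurable_cong)
qed

lemma gain_le:
  assumes "row_summable \<Delta> s" "x \<in> space \<mu>"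
  shows "\<bar>gain \<Delta> s x\<bar> \<le> 2 * b * row_norm \<Delta> s"
  using loglik_lipschitz[OF row_summable_add[OF star_row assms(1)] star_row assms(2)]
  by (simp add: gain_def)

section \<open>The conditional law of one site under the true matrix\<close>

abbreviation f :: "'s \<Rightarrow> ('s \<Rightarrow> 'x) \<Rightarrow> 'x \<Rightarrow> real" where
  "f s x u \<equiv> full_cond_density \<rho> A B0 B \<theta>star s x u"

definition \<nu> :: "'s \<Rightarrow> ('s \<Rightarrow> 'x) \<Rightarrow> 'x measure" where
  "\<nu> s x = density \<rho> (\<lambda>u. ennreal (f s x u))"

lemma f_eq: "x \<in> space \<mu> \<Longrightarrow> u \<in> space \<rho> \<Longrightarrow> f s x u = exp (A u + energy \<theta>star s x u) / Z \<theta>star s x"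
  by (rule full_cond_density_eq[OF star_row])

lemma f_nonneg: "x \<in> space \<mu> \<Longrightarrow> u \<in> space \<rho> \<Longrightarrow> 0 \<le> f s x u"
  using f_eq Z_pos[OF star_row] by (simp add: less_imp_le)

text \<open>Joint measurability in configuration and state, read off the explicit formula, is what
  the product integrals in \<open>resample\<close> require.\<close>

lemma f_meas: "(\<lambda>(x, u). f s x u) \<in> borel_measurable (\<mu> \<Otimes>\<^sub>M \<rho>)"
proof -
  have [measurable]: "(\<lambda>p. energy \<theta>star s (fst p) (snd p)) \<in> borel_measurable (\<mu> \<Otimes>\<^sub>M \<rho>)"
    using energy_meas[OF star_row, of s] by (simp add: case_prod_unfold)
  note [measurable] = Z_meas[OF star_row]
  have "(\<lambda>p. exp (A (snd p) + energy \<theta>star s (fst p) (snd p)) / Z \<theta>star s (fst p))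
          \<in> borel_measurable (\<mu> \<Otimes>\<^sub>M \<rho>)"
    by measurable
  then show ?thesis
    by (rule measurable_cong[THEN iffD1, rotated]) (auto simp: space_pair_measure f_eq)
qed

lemma f_meas_u: "x \<in> space \<mu> \<Longrightarrow> f s x \<in> borel_measurable \<rho>"
  using measurable_Pair2[OF f_meas] by simp

lemma f_integral:
  assumes x: "x \<in> space \<mu>"
  shows "integrable \<rho> (f s x)" "(\<integral>u. f s x u \<partial>\<rho>) = 1"
proof -
  have c: "integrable \<rho> (f s x) \<longleftrightarrow> integrable \<rho> (\<lambda>u. exp (A u + energy \<theta>star s x u) / Z \<theta>star s x)"
    using f_eq[OF x] by (intro Bochner_Integration.integrable_cong) auto
  show "integrable \<rho> (f s x)"
    unfolding c using weight_integrable[OF star_row x] by simp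
  have "(\<integral>u. f s x u \<partial>\<rho>) = (\<integral>u. exp (A u + energy \<theta>star s x u) / Z \<theta>star s x \<partial>\<rho>)"
    using f_eq[OF x] by (intro Bochner_Integration.integral_cong) auto
  also have "\<dots> = Z \<theta>star s x / Z \<theta>star s x"
    unfolding Z_def[symmetric, of \<theta>star] integral_divide_zero by (simp add: Z_def)
  finally show "(\<integral>u. f s x u \<partial>\<rho>) = 1"
    using Z_pos[OF star_row x, of s] by simp
qed

lemma space_nu [simp]: "space (\<nu> s x) = space \<rho>" and sets_nu [measurable_cong]: "sets (\<nu> s x) = sets \<rho>"
  by (simp_all add: \<nu>_def)

lemma nu_integral:
  fixes g :: "'x \<Rightarrow> real"
  assumes "x \<in> space \<mu>" "g \<in> borel_measurable \<rho>"
  shows "(\<integral>u. g u \<partial>\<nu> s x) = (\<integral>u. f s x u * g u \<partial>\<rho>)"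
  unfolding \<nu>_def using assms f_meas_u f_nonneg
  by (subst integral_density) (auto intro!: AE_I2)

lemma nu_prob:
  assumes x: "x \<in> space \<mu>"
  shows "prob_space (\<nu> s x)"
proof
  have "emeasure (\<nu> s x) (space \<rho>) = (\<integral>\<^sup>+u. ennreal (f s x u) \<partial>\<rho>)"
    unfolding \<nu>_def using f_meas_u[OF x]
    by (subst emeasure_density) (auto intro!: nn_integral_cong)
  also have "\<dots> = 1"
    using f_integral[OF x, of s] f_nonneg[OF x]
    by (subst nn_integral_eq_integral) (auto intro!: AE_I2)
  finally show "emeasure (\<nu> s x) (space (\<nu> s x)) = 1" by simp
qed

section \<open>Redrawing one site leaves the field invariant\<close>

lemma cylinder_set:
  assumes "finite J" "\<And>j. j \<in> J \<Longrightarrow> E j \<in> sets \<rho>"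
  shows "{x \<in> space \<mu>. \<forall>j\<in>J. x j \<in> E j} \<in> sets \<mu>"
proof -
  have [measurable]: "(\<lambda>x. x j) \<in> measurable \<mu> \<rho>" for j
    by (simp add: measurable_cong_sets[OF sets_mu refl])
  note [measurable] = assms
  show ?thesis by measurable
qed

lemma sigma_others_subalgebra: "subalgebra \<mu> (sigma_others \<rho> s)"
  unfolding subalgebra_def
proof
  have sp: "space (\<Pi>\<^sub>M l\<in>(UNIV :: 's set). \<rho>) = space \<mu>"
    using sets_eq_imp_space_eq[OF sets_mu] by simp
  then show "space (sigma_others \<rho> s) = space \<mu>"
    by (simp add: sigma_others_def)
  have "(\<lambda>x. restrict x (UNIV - {s})) \<in> measurable \<mu> (\<Pi>\<^sub>M l\<in>UNIV - {s}. \<rho>)"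
    unfolding measurable_cong_sets[OF sets_mu refl] by (rule measurable_restrict_subset) simp
  then show "sets (sigma_others \<rho> s) \<subseteq> sets \<mu>"
    unfolding sigma_others_def sp by (intro sets_image_in_sets) auto
qed

lemma cylinder_others:
  assumes "finite J" "s \<notin> J" "\<And>j. j \<in> J \<Longrightarrow> E j \<in> sets \<rho>"
  shows "{x \<in> space \<mu>. \<forall>j\<in>J. x j \<in> E j} \<in> sets (sigma_others \<rho> s)"
proof -
  have sp: "space (\<Pi>\<^sub>M l\<in>(UNIV :: 's set). \<rho>) = space \<mu>"
    using sets_eq_imp_space_eq[OF sets_mu] by simp
  let ?N = "\<Pi>\<^sub>M l\<in>UNIV - {s}. \<rho>"
  have "{y \<in> space ?N. \<forall>j\<in>J. y j \<in> E j} \<in> sets ?N"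
  proof -
    have [measurable]: "(\<lambda>y. y j) \<in> measurable ?N \<rho>" if "j \<in> J" for j
      using that assms(2) by (intro measurable_component_singleton) auto
    note [measurable] = assms
    show ?thesis by measurable
  qed
  from in_vimage_algebra[OF this, of "\<lambda>x. restrict x (UNIV - {s})" "space \<mu>"]
  have "(\<lambda>x. restrict x (UNIV - {s})) -` {y \<in> space ?N. \<forall>j\<in>J. y j \<in> E j} \<inter> space \<mu>
          \<in> sets (sigma_others \<rho> s)"
    by (simp add: sigma_others_def sp)
  also have "(\<lambda>x. restrict x (UNIV - {s})) -` {y \<in> space ?N. \<forall>j\<in>J. y j \<in> E j} \<inter> space \<mu> =
      {x \<in> space \<mu>. \<forall>j\<in>J. x j \<in> E j}"
    using assms(2) by (auto simp: space_PiM space_mu)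
  finally show ?thesis .
qed

text \<open>The Gibbs sampler step: replacing coordinate \<open>s\<close> by a draw from its
  conditional law preserves \<open>\<mu>\<close>. Finite-dimensional cylinders determine a finite
  measure on the product. Each cylinder is a condition \<open>E'\<close> on the other coordinates
  and a condition \<open>C\<close> on coordinate \<open>s\<close>, and both sides give it the
  integral of the conditional probability of \<open>C\<close> over \<open>E'\<close>.\<close>

lemma resample: "\<mu> = distr (density (\<mu> \<Otimes>\<^sub>M \<rho>) (\<lambda>(x, u). ennreal (f s x u))) \<mu> (\<lambda>(x, u). x(s := u))"
  (is "_ = distr ?D _ ?upd")
proof (rule measure_eqI_PiM_infinite[where I = UNIV and M = "\<lambda>_. \<rho>"])
  show "finite_measure \<mu>" by (rule mu.finite_measure_axioms)
  show "sets \<mu> = sets (\<Pi>\<^sub>M l\<in>UNIV. \<rho>)" by (rule sets_mu)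
  then show "sets (distr ?D \<mu> ?upd) = sets (\<Pi>\<^sub>M l\<in>UNIV. \<rho>)" by simp
  fix E :: "'s \<Rightarrow> 'x set" and J
  assume J: "finite J" and E: "\<And>i. i \<in> J \<Longrightarrow> E i \<in> sets \<rho>"
  define E' where "E' = {x \<in> space \<mu>. \<forall>j\<in>J - {s}. x j \<in> E j}"
  \<comment> \<open>The full state space stands for the absent condition when the cylinder does not
    restrict coordinate \<open>s\<close>.\<close>
  define C where "C = (if s \<in> J then E s else space \<rho>)"
  have C[measurable]: "C \<in> sets \<rho>" unfolding C_def using E by auto
  have Csub: "C \<subseteq> space \<rho>" using sets.sets_into_space[OF C] .
  have E'F: "E' \<in> sets (sigma_others \<rho> s)"
    unfolding E'_def by (rule cylinder_others) (use J E in auto)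
  have E'[measurable]: "E' \<in> sets \<mu>"
    unfolding E'_def by (rule cylinder_set) (use J E in auto)
  have cyl: "prod_emb UNIV (\<lambda>_. \<rho>) J (Pi\<^sub>E J E) = {x \<in> space \<mu>. \<forall>j\<in>J. x j \<in> E j}"
    by (auto simp: prod_emb_def space_mu PiE_iff extensional_def)
  define G where "G = {x \<in> space \<mu>. \<forall>j\<in>J. x j \<in> E j}"
  have G[measurable]: "G \<in> sets \<mu>" unfolding G_def by (rule cylinder_set) (use J E in auto)
  have ind: "indicator G x = (indicator E' x * indicator C (x s) :: real)" if "x \<in> space \<mu>" for x
    using that in_space_mu[OF that, of s] by (auto simp: G_def E'_def C_def indicator_def)
  have indu: "indicator G (x(s := u)) = (indicator E' x * indicator C u :: real)"
    if "x \<in> space \<mu>" "u \<in> space \<rho>" for x u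
    using that upd_in_space_mu[OF that, of s] by (auto simp: G_def E'_def C_def indicator_def)
  have [measurable]: "(\<lambda>x. x s) \<in> measurable \<mu> \<rho>"
    by (simp add: measurable_cong_sets[OF sets_mu refl])
  interpret F: finite_measure_subalgebra \<mu> "sigma_others \<rho> s"
    by unfold_locales (rule sigma_others_subalgebra)
  define k where "k x = (\<integral>u. indicator C u * f s x u \<partial>\<rho>)" for x
  have kmeas[measurable]: "k \<in> borel_measurable \<mu>"
  proof -
    have [measurable]: "(\<lambda>p. f s (fst p) (snd p)) \<in> borel_measurable (\<mu> \<Otimes>\<^sub>M \<rho>)"
      using f_meas[of s] by (simp add: case_prod_unfold)
    show ?thesis unfolding k_def[abs_def] by measurable
  qed
  have kint: "integrable \<rho> (\<lambda>u. indicator C u * f s x u)" if "x \<in> space \<mu>" for x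
    using integrable_mult_indicator[OF C f_integral(1)[OF that]] by simp
  have k01: "0 \<le> k x" "k x \<le> 1" if "x \<in> space \<mu>" for x
  proof -
    show "0 \<le> k x" unfolding k_def using f_nonneg[OF that] by (intro integral_nonneg_AE AE_I2) auto
    have "k x \<le> (\<integral>u. f s x u \<partial>\<rho>)"
      unfolding k_def using kint[OF that] f_integral(1)[OF that] f_nonneg[OF that]
      by (intro integral_mono) (auto simp: indicator_def)
    then show "k x \<le> 1" using f_integral(2)[OF that] by simp
  qed
  have iE: "integrable \<mu> (\<lambda>x. indicator E' x * indicator C (x s) :: real)"
    by (rule mu.integrable_const_bound[where B = 1]) (auto simp: indicator_def)
  have "measure \<mu> G = (\<integral>x. indicator G x \<partial>\<mu>)" by simp
  also have "\<dots> = (\<integral>x. indicator E' x * indicator C (x s) \<partial>\<mu>)"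
    by (intro Bochner_Integration.integral_cong refl ind)
  \<comment> \<open>The defining property of conditional expectation: \<open>E'\<close> depends on
    the other coordinates only, so its indicator is measurable for
    \<open>sigma_others \<rho> s\<close>.\<close>
  also have "\<dots> = (\<integral>x. indicator E' x * real_cond_exp \<mu> (sigma_others \<rho> s) (\<lambda>y. indicator C (y s)) x \<partial>\<mu>)"
    by (rule F.real_cond_exp_intg(2)[symmetric]) (use iE E'F in auto)
  also have "\<dots> = (\<integral>x. indicator E' x * k x \<partial>\<mu>)"
  proof (rule integral_cong_AE)
    have "AE x in \<mu>. real_cond_exp \<mu> (sigma_others \<rho> s) (\<lambda>y. indicator C (y s)) x = k x"
      using law C unfolding field_law_def k_def by blast
    then show "AE x in \<mu>. indicator E' x * real_cond_exp \<mu> (sigma_others \<rho> s) (\<lambda>y. indicator C (y s)) x =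
        indicator E' x * k x"
      by eventually_elim simp
  qed auto
  finally have lhs: "measure \<mu> G = (\<integral>x. indicator E' x * k x \<partial>\<mu>)" .
  have fm[measurable]: "(\<lambda>p. f s (fst p) (snd p)) \<in> borel_measurable (\<mu> \<Otimes>\<^sub>M \<rho>)"
    using f_meas[of s] by (simp add: case_prod_unfold)
  have updm: "?upd \<in> measurable ?D \<mu>"
    using upd_meas[of s] by (simp add: measurable_density_eq1 measurable_cong_sets[OF sets_density refl])
  have "emeasure (distr ?D \<mu> ?upd) G = (\<integral>\<^sup>+p. indicator G (?upd p) \<partial>?D)"
    using updm by (subst nn_integral_indicator[symmetric], simp) (subst nn_integral_distr, auto)
  also have "\<dots> = (\<integral>\<^sup>+p. ennreal (f s (fst p) (snd p)) * indicator G (?upd p) \<partial>(\<mu> \<Otimes>\<^sub>M \<rho>))"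
    using measurable_compose[OF upd_meas[of s], of "indicator G :: _ \<Rightarrow> ennreal" borel]
    by (subst nn_integral_density) (auto simp: case_prod_unfold)
  also have "\<dots> = (\<integral>\<^sup>+p. ennreal (indicator E' (fst p) * (indicator C (snd p) * f s (fst p) (snd p)))
                     \<partial>(\<mu> \<Otimes>\<^sub>M \<rho>))"
  proof (rule nn_integral_cong)
    fix p assume "p \<in> space (\<mu> \<Otimes>\<^sub>M \<rho>)"
    then have p: "fst p \<in> space \<mu>" "snd p \<in> space \<rho>" by (auto simp: space_pair_measure)
    have "indicator G (?upd p) = ennreal (indicator G (?upd p))" by (simp add: indicator_def)
    also have "\<dots> = ennreal (indicator E' (fst p) * indicator C (snd p))"
      using indu[OF p] by (simp add: case_prod_unfold)
    finally show "ennreal (f s (fst p) (snd p)) * indicator G (?upd p) =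
        ennreal (indicator E' (fst p) * (indicator C (snd p) * f s (fst p) (snd p)))"
      using f_nonneg[OF p] by (simp add: ennreal_mult[symmetric] ac_simps)
  qed
  also have "\<dots> = (\<integral>\<^sup>+x. \<integral>\<^sup>+u. ennreal (indicator E' x * (indicator C u * f s x u)) \<partial>\<rho> \<partial>\<mu>)"
    by (subst nn_integral_fst[symmetric]) auto
  also have "\<dots> = (\<integral>\<^sup>+x. ennreal (indicator E' x * k x) \<partial>\<mu>)"
  proof (rule nn_integral_cong)
    fix x assume x: "x \<in> space \<mu>"
    have "(\<integral>\<^sup>+u. ennreal (indicator E' x * (indicator C u * f s x u)) \<partial>\<rho>) =
        ennreal (\<integral>u. indicator E' x * (indicator C u * f s x u) \<partial>\<rho>)"
      using kint[OF x] f_nonneg[OF x] by (intro nn_integral_eq_integral) auto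
    then show "(\<integral>\<^sup>+u. ennreal (indicator E' x * (indicator C u * f s x u)) \<partial>\<rho>) =
        ennreal (indicator E' x * k x)"
      by (simp add: k_def)
  qed
  also have "\<dots> = ennreal (\<integral>x. indicator E' x * k x \<partial>\<mu>)"
  proof (rule nn_integral_eq_integral)
    show "integrable \<mu> (\<lambda>x. indicator E' x * k x)"
      by (rule mu.integrable_const_bound[where B = 1]) (use k01 in \<open>auto simp: indicator_def\<close>)
  qed (use k01 in auto)
  finally show "emeasure \<mu> (prod_emb UNIV (\<lambda>_. \<rho>) J (Pi\<^sub>E J E)) =
      emeasure (distr ?D \<mu> ?upd) (prod_emb UNIV (\<lambda>_. \<rho>) J (Pi\<^sub>E J E))"
    unfolding cyl G_def[symmetric] by (simp add: mu.emeasure_eq_measure lhs)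
qed

text \<open>The invariance in the form of a tower property: averaging over coordinate
  \<open>s\<close> under \<open>\<nu> s x\<close> first does not change the mean.\<close>

lemma resample_integral:
  fixes g :: "('s \<Rightarrow> 'x) \<Rightarrow> real"
  assumes [measurable]: "g \<in> borel_measurable \<mu>" and bnd: "\<And>x. x \<in> space \<mu> \<Longrightarrow> \<bar>g x\<bar> \<le> c"
  shows "(\<integral>x. g x \<partial>\<mu>) = (\<integral>x. (\<integral>u. g (x(s := u)) \<partial>\<nu> s x) \<partial>\<mu>)"
proof -
  let ?D = "density (\<mu> \<Otimes>\<^sub>M \<rho>) (\<lambda>(x, u). ennreal (f s x u))"
  interpret pair_sigma_finite \<mu> \<rho> ..
  have fm[measurable]: "(\<lambda>p. f s (fst p) (snd p)) \<in> borel_measurable (\<mu> \<Otimes>\<^sub>M \<rho>)"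
    using f_meas[of s] by (simp add: case_prod_unfold)
  have gm[measurable]: "(\<lambda>p. g ((fst p)(s := snd p))) \<in> borel_measurable (\<mu> \<Otimes>\<^sub>M \<rho>)"
    using measurable_compose[OF upd_meas assms(1)] by (simp add: case_prod_unfold)
  have D: "?D = density (\<mu> \<Otimes>\<^sub>M \<rho>) (\<lambda>p. ennreal (f s (fst p) (snd p)))"
    by (simp add: case_prod_unfold)
  have updm: "(\<lambda>(x, u). x(s := u)) \<in> measurable ?D \<mu>"
    using upd_meas[of s] by (simp add: measurable_cong_sets[OF sets_density refl])
  have nn: "AE p in \<mu> \<Otimes>\<^sub>M \<rho>. 0 \<le> f s (fst p) (snd p)"
    using f_nonneg by (intro AE_I2) (auto simp: space_pair_measure)
  \<comment> \<open>The total mass is read off the image measure, which is \<open>\<mu>\<close> by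
    \<open>resample\<close>.\<close>
  have prob: "prob_space ?D"
    using mu.prob_space_axioms resample[of s] updm prob_space_distrD by metis
  have intD: "integrable ?D (\<lambda>p. g ((fst p)(s := snd p)))"
    by (rule finite_measure.integrable_const_bound[OF prob_space.finite_measure[OF prob], where B = c])
       (use bnd upd_in_space_mu in \<open>auto simp: space_pair_measure intro!: AE_I2\<close>)
  have int: "integrable (\<mu> \<Otimes>\<^sub>M \<rho>) (\<lambda>p. f s (fst p) (snd p) * g ((fst p)(s := snd p)))"
    using intD unfolding D by (subst (asm) integrable_density) (use nn in auto)
  have "(\<integral>x. g x \<partial>\<mu>) = (\<integral>x. g x \<partial>distr ?D \<mu> (\<lambda>(x, u). x(s := u)))"
    using resample[of s] by simp
  also have "\<dots> = (\<integral>p. g ((fst p)(s := snd p)) \<partial>?D)"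
    using updm by (subst integral_distr) (auto simp: case_prod_unfold)
  also have "\<dots> = (\<integral>p. f s (fst p) (snd p) * g ((fst p)(s := snd p)) \<partial>(\<mu> \<Otimes>\<^sub>M \<rho>))"
    unfolding D by (subst integral_density) (use nn in auto)
  also have "\<dots> = (\<integral>x. (\<integral>u. f s x u * g (x(s := u)) \<partial>\<rho>) \<partial>\<mu>)"
    using integral_fst'[OF int] by simp
  also have "\<dots> = (\<integral>x. (\<integral>u. g (x(s := u)) \<partial>\<nu> s x) \<partial>\<mu>)"
  proof (rule Bochner_Integration.integral_cong[OF refl])
    fix x assume x: "x \<in> space \<mu>"
    have "(\<lambda>u. g (x(s := u))) \<in> borel_measurable \<rho>"
      using measurable_Pair2[OF gm x] by simp
    then show "(\<integral>u. f s x u * g (x(s := u)) \<partial>\<rho>) = (\<integral>u. g (x(s := u)) \<partial>\<nu> s x)"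
      using nu_integral[OF x] by simp
  qed
  finally show ?thesis .
qed

section \<open>Expected log likelihood ratios\<close>

lemma nu_integral_meas:
  fixes g :: "('s \<Rightarrow> 'x) \<Rightarrow> 'x \<Rightarrow> real"
  assumes "(\<lambda>(x, u). g x u) \<in> borel_measurable (\<mu> \<Otimes>\<^sub>M \<rho>)"
  shows "(\<lambda>x. \<integral>u. g x u \<partial>\<nu> s x) \<in> borel_measurable \<mu>"
proof -
  have [measurable]: "(\<lambda>p. f s (fst p) (snd p)) \<in> borel_measurable (\<mu> \<Otimes>\<^sub>M \<rho>)"
    "(\<lambda>p. g (fst p) (snd p)) \<in> borel_measurable (\<mu> \<Otimes>\<^sub>M \<rho>)"
    using f_meas[of s] assms by (simp_all add: case_prod_unfold)
  \<comment> \<open>Here \<open>x\<close> enters the measure as well as the integrand; writing out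
    the density leaves an ordinary parameter integral against the fixed measure
    \<open>\<rho>\<close>.\<close>
  have "(\<lambda>x. \<integral>u. f s x u * g x u \<partial>\<rho>) \<in> borel_measurable \<mu>"
    by measurable
  then show ?thesis
    by (rule measurable_cong[THEN iffD1, rotated])
       (use nu_integral measurable_Pair2[OF assms] in simp)
qed

lemma nu_cov_meas:
  fixes g h :: "('s \<Rightarrow> 'x) \<Rightarrow> 'x \<Rightarrow> real"
  assumes "(\<lambda>(x, u). g x u) \<in> borel_measurable (\<mu> \<Otimes>\<^sub>M \<rho>)"
    "(\<lambda>(x, u). h x u) \<in> borel_measurable (\<mu> \<Otimes>\<^sub>M \<rho>)"
  shows "(\<lambda>x. cov (\<nu> s x) (g x) (h x)) \<in> borel_measurable \<mu>"
  unfolding cov_def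
proof (rule nu_integral_meas)
  note [measurable] = nu_integral_meas[OF assms(1), of s] nu_integral_meas[OF assms(2), of s]
  have [measurable]: "(\<lambda>p. g (fst p) (snd p)) \<in> borel_measurable (\<mu> \<Otimes>\<^sub>M \<rho>)"
    "(\<lambda>p. h (fst p) (snd p)) \<in> borel_measurable (\<mu> \<Otimes>\<^sub>M \<rho>)"
    using assms by (simp_all add: case_prod_unfold)
  have "(\<lambda>p. (g (fst p) (snd p) - (\<integral>v. g (fst p) v \<partial>\<nu> s (fst p))) *
             (h (fst p) (snd p) - (\<integral>v. h (fst p) v \<partial>\<nu> s (fst p)))) \<in> borel_measurable (\<mu> \<Otimes>\<^sub>M \<rho>)"
    by measurable
  then show "(\<lambda>(x, w). (g x w - (\<integral>v. g x v \<partial>\<nu> s x)) * (h x w - (\<integral>v. h x v \<partial>\<nu> s x)))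
      \<in> borel_measurable (\<mu> \<Otimes>\<^sub>M \<rho>)"
    by (simp add: case_prod_unfold)
qed

text \<open>\<open>cov_infsum\<close> holds for each \<open>x\<close>, and the bound
  \<open>4 * b * b\<close> on the single covariances allows integration over \<open>\<mu>\<close>
  term by term. This is where the quadratic form in the positive definiteness hypothesis
  arises.\<close>

lemma expected_variance:
  assumes "row_summable \<Delta> s"
  shows "(\<integral>x. cov (\<nu> s x) (energy \<Delta> s x) (energy \<Delta> s x) \<partial>\<mu>) =
           (\<Sum>\<^sub>\<infinity>(l, l')\<in>UNIV. \<Delta> s l * \<Delta> s l' * cov_matrix \<rho> A B0 B \<mu> \<theta>star s l l')"
proof -
  let ?\<phi> = "\<lambda>x l u. B u ((x(s := u)) l)"
  have \<phi>m: "?\<phi> x l \<in> borel_measurable \<rho>" if "x \<in> space \<mu>" for x l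
    using measurable_Pair2[OF stat_meas that] by simp
  have \<phi>b: "\<bar>?\<phi> x l u\<bar> \<le> b" if "x \<in> space \<mu>" "u \<in> space \<rho>" for x l u
    by (rule B_le[OF that(2) upd_space[OF that]])
  have "(\<integral>x. cov (\<nu> s x) (energy \<Delta> s x) (energy \<Delta> s x) \<partial>\<mu>) =
      (\<integral>x. (\<Sum>\<^sub>\<infinity>p. \<Delta> s (fst p) * \<Delta> s (snd p) * cov (\<nu> s x) (?\<phi> x (fst p)) (?\<phi> x (snd p))) \<partial>\<mu>)"
  proof (intro Bochner_Integration.integral_cong refl)
    fix x assume x: "x \<in> space \<mu>"
    show "cov (\<nu> s x) (energy \<Delta> s x) (energy \<Delta> s x) =
        (\<Sum>\<^sub>\<infinity>p. \<Delta> s (fst p) * \<Delta> s (snd p) * cov (\<nu> s x) (?\<phi> x (fst p)) (?\<phi> x (snd p)))"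
      using cov_infsum[OF nu_prob[OF x, of s], of "?\<phi> x" b "\<Delta> s"] \<phi>m[OF x] \<phi>b[OF x] assms
      by (simp add: energy_def[abs_def] case_prod_unfold row_summable_def
            measurable_cong_sets[OF sets_nu refl] del: fun_upd_apply)
  qed
  also have "\<dots> = (\<Sum>\<^sub>\<infinity>p. \<integral>x. \<Delta> s (fst p) * \<Delta> s (snd p) * cov (\<nu> s x) (?\<phi> x (fst p)) (?\<phi> x (snd p)) \<partial>\<mu>)"
  proof (rule integral_infsum_bounded[OF mu.finite_measure_axioms])
    show "(\<lambda>x. \<Delta> s (fst p) * \<Delta> s (snd p) * cov (\<nu> s x) (?\<phi> x (fst p)) (?\<phi> x (snd p)))
        \<in> borel_measurable \<mu>" for p
      using nu_cov_meas[OF stat_meas[of s "fst p"] stat_meas[of s "snd p"], of s]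
      by (intro borel_measurable_times borel_measurable_const) auto
    show "\<bar>\<Delta> s (fst p) * \<Delta> s (snd p) * cov (\<nu> s x) (?\<phi> x (fst p)) (?\<phi> x (snd p))\<bar> \<le>
        \<bar>\<Delta> s (fst p)\<bar> * \<bar>\<Delta> s (snd p)\<bar> * (4 * b * b)" if x: "x \<in> space \<mu>" for p x
      unfolding abs_mult
    proof (intro mult_left_mono)
      show "\<bar>cov (\<nu> s x) (?\<phi> x (fst p)) (?\<phi> x (snd p))\<bar> \<le> 4 * b * b"
        by (rule cov_abs_le(2)[OF nu_prob[OF x]])
           (use \<phi>m[OF x] \<phi>b[OF x] in \<open>auto simp: measurable_cong_sets[OF sets_nu refl] simp del: fun_upd_apply\<close>)
    qed auto
    show "(\<lambda>p. \<bar>\<Delta> s (fst p)\<bar> * \<bar>\<Delta> s (snd p)\<bar> * (4 * b * b)) summable_on UNIV"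
      using infsum_mult_pairs(1)[of "\<Delta> s" "\<Delta> s"] assms
      by (intro summable_on_cmult_left) (simp add: case_prod_unfold row_summable_def)
  qed
  also have "\<dots> = (\<Sum>\<^sub>\<infinity>(l, l')\<in>UNIV. \<Delta> s l * \<Delta> s l' * cov_matrix \<rho> A B0 B \<mu> \<theta>star s l l')"
    by (rule infsum_cong) (simp add: cov_matrix_def \<nu>_def case_prod_unfold del: fun_upd_apply)
  finally show ?thesis .
qed

text \<open>The normalizing constants do not see the redrawn coordinate, and
  \<open>Z (\<theta>star + \<Delta>) s x / Z \<theta>star s x\<close> is the mean of
  \<open>exp (energy \<Delta> s x u)\<close> under \<open>\<nu> s x\<close>. The conditional mean
  gain is therefore the deficit in Jensen's inequality.\<close>

lemma gain_resampled:
  assumes \<Delta>: "row_summable \<Delta> s" and x: "x \<in> space \<mu>"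
  shows "(\<integral>u. gain \<Delta> s (x(s := u)) \<partial>\<nu> s x) =
           (\<integral>u. energy \<Delta> s x u \<partial>\<nu> s x) - ln (\<integral>u. exp (energy \<Delta> s x u) \<partial>\<nu> s x)"
proof -
  interpret nu: prob_space "\<nu> s x" by (rule nu_prob[OF x])
  note [measurable] = energy_meas_u[OF \<Delta> x]
  have Zupd: "Z \<theta> s (x(s := u)) = Z \<theta> s x" for \<theta> u
    by (simp add: Z_def)
  have star\<Delta>: "row_summable (\<theta>star + \<Delta>) s" by (rule row_summable_add[OF star_row \<Delta>])
  define r where "r = ln (Z (\<theta>star + \<Delta>) s x) - ln (Z \<theta>star s x)"
  have int: "integrable (\<nu> s x) (energy \<Delta> s x)"
    by (rule nu.integrable_const_bound[where B = "b * row_norm \<Delta> s"])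
       (use energy_le[OF \<Delta> x] in auto)
  have "(\<integral>u. gain \<Delta> s (x(s := u)) \<partial>\<nu> s x) = (\<integral>u. energy \<Delta> s x u - r \<partial>\<nu> s x)"
    by (intro Bochner_Integration.integral_cong refl)
       (simp add: gain_eq[OF \<Delta> upd_in_space_mu[OF x]] Zupd r_def)
  also have "\<dots> = (\<integral>u. energy \<Delta> s x u \<partial>\<nu> s x) - r"
    using int nu.prob_space by simp
  also have "r = ln (\<integral>u. exp (energy \<Delta> s x u) \<partial>\<nu> s x)"
  proof -
    have "(\<integral>u. exp (energy \<Delta> s x u) \<partial>\<nu> s x) = (\<integral>u. f s x u * exp (energy \<Delta> s x u) \<partial>\<rho>)"
      by (rule nu_integral[OF x]) measurable
    also have "\<dots> = (\<integral>u. exp (A u + energy (\<theta>star + \<Delta>) s x u) / Z \<theta>star s x \<partial>\<rho>)"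
    proof (intro Bochner_Integration.integral_cong refl)
      fix u assume u: "u \<in> space \<rho>"
      show "f s x u * exp (energy \<Delta> s x u) = exp (A u + energy (\<theta>star + \<Delta>) s x u) / Z \<theta>star s x"
        using energy_diff[OF star\<Delta> star_row x u] f_eq[OF x u, of s]
        by (simp add: mult_exp_exp)
    qed
    also have "\<dots> = Z (\<theta>star + \<Delta>) s x / Z \<theta>star s x"
      by (simp add: Z_def)
    finally show ?thesis
      using Z_pos[OF star\<Delta> x] Z_pos[OF star_row x, of s] by (simp add: r_def ln_div)
  qed
  finally show ?thesis .
qed

text \<open>The energy is bounded by \<open>c\<close> for every configuration, so a single
  \<open>\<kappa>\<close> works for all \<open>\<nu> s x\<close> and survives integration over
  \<open>\<mu>\<close>. The first claim gives the strict drift at one site, the second makes further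
  sites harmless.\<close>

lemma expected_gain:
  assumes \<Delta>: "row_summable \<Delta> s"
  shows "\<exists>\<kappa>>0. (\<integral>x. gain \<Delta> s x \<partial>\<mu>) \<le> - \<kappa> *
           (\<Sum>\<^sub>\<infinity>(l, l')\<in>UNIV. \<Delta> s l * \<Delta> s l' * cov_matrix \<rho> A B0 B \<mu> \<theta>star s l l')"
    and "(\<integral>x. gain \<Delta> s x \<partial>\<mu>) \<le> 0"
proof -
  define c where "c = b * row_norm \<Delta> s"
  have c: "c \<ge> 0" unfolding c_def by (intro mult_nonneg_nonneg b_nonneg row_norm_nonneg)
  obtain \<kappa> where \<kappa>: "\<kappa> > 0" and gap: "\<And>(M :: 'x measure) h. prob_space M \<Longrightarrow> h \<in> borel_measurable M \<Longrightarrow>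
       (\<And>x. x \<in> space M \<Longrightarrow> \<bar>h x\<bar> \<le> c) \<Longrightarrow>
       (\<integral>x. h x \<partial>M) - ln (\<integral>x. exp (h x) \<partial>M) \<le> - \<kappa> * cov M h h"
    using jensen_exp_gap[OF c] by blast
  let ?V = "\<lambda>x. cov (\<nu> s x) (energy \<Delta> s x) (energy \<Delta> s x)"
  have em: "energy \<Delta> s x \<in> borel_measurable (\<nu> s x)" if "x \<in> space \<mu>" for x
    using energy_meas_u[OF \<Delta> that] by (simp add: measurable_cong_sets[OF sets_nu refl])
  have eb: "\<bar>energy \<Delta> s x u\<bar> \<le> c" if "x \<in> space \<mu>" "u \<in> space (\<nu> s x)" for x u
    using energy_le[OF \<Delta>] that by (simp add: c_def)
  have Vm[measurable]: "?V \<in> borel_measurable \<mu>"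
    by (rule nu_cov_meas[OF energy_meas[OF \<Delta>] energy_meas[OF \<Delta>]])
  have Vint: "integrable \<mu> ?V"
    by (rule mu.integrable_const_bound[where B = "4 * c * c"])
       (use cov_abs_le(2)[OF nu_prob em em eb eb] in \<open>auto intro!: AE_I2\<close>)
  have gm: "gain \<Delta> s \<in> borel_measurable \<mu>" by (rule gain_meas[OF \<Delta>])
  have gm': "(\<lambda>(x, u). gain \<Delta> s (x(s := u))) \<in> borel_measurable (\<mu> \<Otimes>\<^sub>M \<rho>)"
    using measurable_compose[OF upd_meas gm] by (simp add: case_prod_unfold)
  have gb: "\<bar>\<integral>u. gain \<Delta> s (x(s := u)) \<partial>\<nu> s x\<bar> \<le> 2 * b * row_norm \<Delta> s" if x: "x \<in> space \<mu>" for x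
  proof -
    interpret nu: prob_space "\<nu> s x" by (rule nu_prob[OF x])
    have [measurable]: "(\<lambda>u. gain \<Delta> s (x(s := u))) \<in> borel_measurable (\<nu> s x)"
      using measurable_Pair2[OF gm' x] by (simp add: measurable_cong_sets[OF sets_nu refl])
    have le: "\<bar>gain \<Delta> s (x(s := u))\<bar> \<le> 2 * b * row_norm \<Delta> s" if "u \<in> space \<rho>" for u
      by (rule gain_le[OF \<Delta> upd_in_space_mu[OF x that]])
    have i: "integrable (\<nu> s x) (\<lambda>u. gain \<Delta> s (x(s := u)))"
      by (rule nu.integrable_const_bound[where B = "2 * b * row_norm \<Delta> s"]) (use le in auto)
    have "\<bar>\<integral>u. gain \<Delta> s (x(s := u)) \<partial>\<nu> s x\<bar> \<le> (\<integral>u. \<bar>gain \<Delta> s (x(s := u))\<bar> \<partial>\<nu> s x)" by simp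
    also have "\<dots> \<le> (\<integral>u. 2 * b * row_norm \<Delta> s \<partial>\<nu> s x)"
      using i le by (intro integral_mono) auto
    finally show ?thesis using nu.prob_space by simp
  qed
  have gint: "integrable \<mu> (\<lambda>x. \<integral>u. gain \<Delta> s (x(s := u)) \<partial>\<nu> s x)"
    by (rule mu.integrable_const_bound[where B = "2 * b * row_norm \<Delta> s"])
       (use gb nu_integral_meas[OF gm'] in auto)
  have "(\<integral>x. gain \<Delta> s x \<partial>\<mu>) = (\<integral>x. (\<integral>u. gain \<Delta> s (x(s := u)) \<partial>\<nu> s x) \<partial>\<mu>)"
    by (rule resample_integral[OF gm gain_le[OF \<Delta>]])
  also have "\<dots> \<le> (\<integral>x. - \<kappa> * ?V x \<partial>\<mu>)"
  proof (rule integral_mono[OF gint])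
    show "integrable \<mu> (\<lambda>x. - \<kappa> * ?V x)" using Vint by simp
    show "(\<integral>u. gain \<Delta> s (x(s := u)) \<partial>\<nu> s x) \<le> - \<kappa> * ?V x" if x: "x \<in> space \<mu>" for x
      unfolding gain_resampled[OF \<Delta> x] by (rule gap[OF nu_prob[OF x] em[OF x] eb[OF x]])
  qed
  also have "\<dots> = - \<kappa> * (\<integral>x. ?V x \<partial>\<mu>)" by simp
  finally have le: "(\<integral>x. gain \<Delta> s x \<partial>\<mu>) \<le> - \<kappa> * (\<integral>x. ?V x \<partial>\<mu>)" .
  then show "\<exists>\<kappa>>0. (\<integral>x. gain \<Delta> s x \<partial>\<mu>) \<le> - \<kappa> *
           (\<Sum>\<^sub>\<infinity>(l, l')\<in>UNIV. \<Delta> s l * \<Delta> s l' * cov_matrix \<rho> A B0 B \<mu> \<theta>star s l l')"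
    using \<kappa> expected_variance[OF \<Delta>] by auto
  have "(\<integral>x. ?V x \<partial>\<mu>) \<ge> 0"
    by (rule integral_nonneg_AE) (auto simp: cov_def)
  then show "(\<integral>x. gain \<Delta> s x \<partial>\<mu>) \<le> 0"
    using le \<kappa> mult_nonneg_nonneg[of \<kappa> "\<integral>x. ?V x \<partial>\<mu>"] by linarith
qed

text \<open>Entries outside \<open>\<Lambda>\<close> vanish, so the restricted interaction sum is
  the full one, and the pseudo-likelihood is covered by the theory of full conditional
  densities.\<close>

lemma cond_density_fin_mats:
  assumes "\<theta> \<in> fin_mats \<Lambda>"
  shows "cond_density \<rho> A B0 B \<theta> (\<Lambda> - {s}) s = full_cond_density \<rho> A B0 B \<theta> s"
proof -
  have "(\<Sum>\<^sub>\<infinity>l\<in>\<Lambda> - {s}. \<theta> s l * B u (x l)) = (\<Sum>\<^sub>\<infinity>l\<in>UNIV - {s}. \<theta> s l * B u (x l))" for x u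
    by (rule infsum_cong_neutral) (use assms in \<open>auto simp: fin_mats_def\<close>)
  then show ?thesis
    by (simp add: fun_eq_iff cond_density_def cond_weight_def)
qed

lemma loglik_row_cong: "\<theta> s = \<eta> s \<Longrightarrow> loglik \<theta> s = loglik \<eta> s"
  by (simp add: fun_eq_iff loglik_def cond_density_def cond_weight_def)

text \<open>Meant for \<open>H\<close> the estimator, \<open>T\<close> the truncated true matrix and
  \<open>\<Delta>\<close> a fixed approximation of \<open>H - T\<close>. On \<open>F\<close> the
  gain of \<open>\<Delta>\<close> is kept exactly, as its mean is negative; off \<open>F\<close> it
  is replaced by its Lipschitz bound, which a good choice of \<open>F\<close> makes small.\<close>

lemma loglik_sum_diff_le:
  assumes \<Lambda>: "finite \<Lambda>" "F \<subseteq> \<Lambda>" and T: "\<And>s. s \<in> F \<Longrightarrow> T s = \<theta>star s"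
    and row: "\<And>s. row_summable H s" "\<And>s. row_summable T s" "\<And>s. row_summable \<Delta> s"
    and x: "x \<in> space \<mu>"
  shows "(\<Sum>s\<in>\<Lambda>. loglik H s x - loglik T s x) \<le>
           (\<Sum>s\<in>F. gain \<Delta> s x) + 2 * b * (\<Sum>s\<in>\<Lambda> - F. row_norm \<Delta> s)
             + 2 * b * (\<Sum>s\<in>\<Lambda>. row_norm (H - T - \<Delta>) s)"
proof -
  let ?r = "\<lambda>s. row_norm (H - T - \<Delta>) s"
  have inF: "loglik H s x - loglik T s x \<le> gain \<Delta> s x + 2 * b * ?r s" if "s \<in> F" for s
  proof -
    \<comment> \<open>On \<open>F\<close> the rows of \<open>T\<close> and
      \<open>\<theta>star\<close> agree, so the approximation error is also the distance of
      \<open>H\<close> from \<open>\<theta>star + \<Delta>\<close> in that row.\<close>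
    have "row_norm (H - (\<theta>star + \<Delta>)) s = ?r s"
      using T[OF that] by (simp add: row_norm_def algebra_simps)
    moreover have "loglik T s x = loglik \<theta>star s x"
      using loglik_row_cong[of T s \<theta>star] T[OF that] by simp
    ultimately show ?thesis
      using loglik_lipschitz[OF row(1) row_summable_add[OF star_row row(3)] x, of s]
      by (simp add: gain_def)
  qed
  have notF: "loglik H s x - loglik T s x \<le> 2 * b * row_norm \<Delta> s + 2 * b * ?r s" for s
  proof -
    have "H - T = (H - T - \<Delta>) + \<Delta>" by (simp add: fun_eq_iff)
    then have "row_norm (H - T) s \<le> ?r s + row_norm \<Delta> s"
      using row_norm_triangle[OF row_summable_diff[OF row_summable_diff[OF row(1,2)] row(3)] row(3), of s]
      by simp
    then have "2 * b * row_norm (H - T) s \<le> 2 * b * (?r s + row_norm \<Delta> s)"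
      using b_nonneg by (intro mult_left_mono) auto
    then show ?thesis
      using loglik_lipschitz[OF row(1,2) x, of s] by (simp add: algebra_simps)
  qed
  have split: "(\<Sum>s\<in>\<Lambda>. g s) = (\<Sum>s\<in>F. g s) + (\<Sum>s\<in>\<Lambda> - F. g s)" for g :: "'s \<Rightarrow> real"
    using sum.subset_diff[OF \<Lambda>(2,1), of g] by simp
  have "(\<Sum>s\<in>\<Lambda>. loglik H s x - loglik T s x) \<le>
      (\<Sum>s\<in>F. gain \<Delta> s x + 2 * b * ?r s) + (\<Sum>s\<in>\<Lambda> - F. 2 * b * row_norm \<Delta> s + 2 * b * ?r s)"
    unfolding split by (intro add_mono sum_mono inF notF)
  also have "\<dots> = (\<Sum>s\<in>F. gain \<Delta> s x) + 2 * b * (\<Sum>s\<in>\<Lambda> - F. row_norm \<Delta> s)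
      + 2 * b * (\<Sum>s\<in>\<Lambda>. ?r s)"
    unfolding split[of ?r] by (simp add: sum.distrib sum_distrib_left algebra_simps)
  finally show ?thesis .
qed

end

section \<open>Consistency\<close>

theorem corollary1p3:
  fixes XX :: "'x::euclidean_space set"
    and \<rho> :: "'x measure"
    and A B0 :: "'x \<Rightarrow> real"
    and B :: "'x \<Rightarrow> 'x \<Rightarrow> real"
    and \<theta>star :: "'s::{countable, linorder} \<Rightarrow> 's \<Rightarrow> real"
    and \<mu> :: "('s \<Rightarrow> 'x) measure"
    and P :: "'w measure"
    and X :: "nat \<Rightarrow> 'w \<Rightarrow> 's \<Rightarrow> 'x"
    and D :: "nat \<Rightarrow> 's set"
    and q :: "real \<Rightarrow> real \<Rightarrow> real"
    and lam :: "nat \<Rightarrow> real"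
    and \<theta>hat :: "nat \<Rightarrow> 'w \<Rightarrow> 's \<Rightarrow> 's \<Rightarrow> real"
  assumes S_infinite: "infinite (UNIV :: 's set)"
    and X_compact: "compact XX"
    and rho_sets: "sets \<rho> = sets (restrict_space borel XX)"
    and rho_finite: "finite_measure \<rho>"
    and rho_nonzero: "emeasure \<rho> (space \<rho>) \<noteq> 0"
    and A_meas: "A \<in> borel_measurable \<rho>"
    and B0_meas: "B0 \<in> borel_measurable \<rho>"
    and B_meas: "(\<lambda>(x, y). B x y) \<in> borel_measurable (\<rho> \<Otimes>\<^sub>M \<rho>)"
    and B_sym: "\<And>x y. x \<in> XX \<Longrightarrow> y \<in> XX \<Longrightarrow> B x y = B y x"
    and B_diag: "\<And>x. x \<in> XX \<Longrightarrow> B x x = B0 x"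
    and mu_law: "field_law \<rho> A B0 B \<theta>star \<mu>"
    and P_prob: "prob_space P"
    and X_indep: "prob_space.indep_vars P (\<lambda>_. \<mu>) X {1..}"
    and X_law: "\<And>i. i \<ge> 1 \<Longrightarrow> distr P \<mu> (X i) = \<mu>"
    and D_mono: "mono_on {1..} D"
    and D_finite: "\<And>n. n \<ge> 1 \<Longrightarrow> finite (D n)"
    and D_union: "(\<Union>n\<in>{1..}. D n) = UNIV"
    and q_nonneg: "\<And>r x. r \<ge> 0 \<Longrightarrow> x \<ge> 0 \<Longrightarrow> q r x \<ge> 0"
    and lam_pos: "\<And>n. n \<ge> 1 \<Longrightarrow> lam n > 0"
    \<comment> \<open>(i)\<close>
    and A_bounded: "bounded (A ` XX)"
    and B0_bounded: "bounded (B0 ` XX)"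
    and B_bounded: "bounded ((\<lambda>(x, y). B x y) ` (XX \<times> XX))"
    \<comment> \<open>(ii)\<close>
    and q_zero: "\<And>r. r \<ge> 0 \<Longrightarrow> q r 0 = 0"
    and q_right_cont: "\<And>r. r \<ge> 0 \<Longrightarrow> continuous (at_right 0) (q r)"
    and q_diff: "\<And>r x. r \<ge> 0 \<Longrightarrow> x > 0 \<Longrightarrow> q r differentiable (at x)"
    and q_deriv_bound: "\<exists>C. \<forall>r>0. \<forall>x>0. \<bar>deriv (q r) x\<bar> / r \<le> C"
    \<comment> \<open>(iii)\<close>
    and theta_star: "\<theta>star \<in> sym_mats"
    and theta_star_nbhd: "\<And>s. finite {l \<in> UNIV - {s}. \<theta>star s l \<noteq> 0}"
    \<comment> \<open>(iv)\<close>
    and lam_rate: "(\<lambda>n. lam n / real n) \<longlonglongrightarrow> 0"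
    \<comment> \<open>(v)\<close>
    and cov_pos_def: "\<And>\<theta> s. \<theta> \<in> sym_mats \<Longrightarrow> pos_def_matrix (cov_matrix \<rho> A B0 B \<mu> \<theta> s)"
    and theta_hat_meas: "\<And>n. n \<ge> 1 \<Longrightarrow> \<theta>hat n \<in> measurable P borel1"
    and theta_hat_argmax: "\<And>n \<omega>. n \<ge> 1 \<Longrightarrow> \<omega> \<in> space P \<Longrightarrow>
      \<theta>hat n \<omega> \<in> Argmax (fin_mats (D n))
        (pen_pseudo_lik \<rho> A B0 B (q (lam n)) (D n) n (\<lambda>i. X i \<omega>))"
    and tight: "uniformly_tight P top1 {1..} (\<lambda>n \<omega>. \<theta>hat n \<omega> - truncate (D n) \<theta>star)"
  shows "tendsto_in_prob P (\<lambda>n \<omega>. norm1 (\<theta>hat n \<omega> - truncate (D n) \<theta>star)) 0"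
proof -
  have sp: "space \<rho> = XX"
    using sets_eq_imp_space_eq[OF rho_sets] by (simp add: space_restrict_space)
  obtain a where a: "\<And>u. u \<in> XX \<Longrightarrow> \<bar>A u\<bar> \<le> a"
    using A_bounded unfolding bounded_iff by auto
  obtain b where b: "\<And>u v. u \<in> XX \<Longrightarrow> v \<in> XX \<Longrightarrow> \<bar>B u v\<bar> \<le> b"
    using B_bounded unfolding bounded_iff by auto
  interpret P: prob_space P by fact
  interpret cond_field \<rho> A B0 B \<theta>star \<mu> a b
    by (intro cond_field.intro cond_field_axioms.intro rho_finite)
       (use rho_nonzero A_meas B_meas a b B_diag mu_law sym_mats_row_summable[OF theta_star]
         in \<open>auto simp: sp\<close>)
  have Xm: "X i \<in> measurable P \<mu>" if "i \<ge> 1" for i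
    using X_indep that unfolding P.indep_vars_def by auto
  have Xsp: "X i \<omega> \<in> space \<mu>" if "i \<ge> 1" "\<omega> \<in> space P" for i \<omega>
    using measurable_space[OF Xm[OF that(1)] that(2)] .
  obtain C where C: "\<And>r x. r > 0 \<Longrightarrow> x > 0 \<Longrightarrow> \<bar>deriv (q r) x\<bar> \<le> C * r"
    using q_deriv_bound by (metis pos_divide_le_eq)
  have C0: "C \<ge> 0" using C[of 1 1] by simp
  have lip: "\<bar>q r \<bar>y\<bar> - q r \<bar>x\<bar>\<bar> \<le> C * r * \<bar>y - x\<bar>" if "r > 0" for r x y
    by (rule penalty_lipschitz) (use q_right_cont q_diff C that in auto)
  interpret M1: Metric_space "sym_mats1 :: ('s \<Rightarrow> 's \<Rightarrow> real) set" "\<lambda>\<theta> \<eta>. norm1 (\<theta> - \<eta>)"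
    by (rule norm1_Metric_space)
  define \<Delta> where "\<Delta> n \<omega> = \<theta>hat n \<omega> - truncate (D n) \<theta>star" for n \<omega>

  \<comment> \<open>The basic inequality, valid for every sample\<close>
  have core: "- (C * lam n * norm1 (\<Delta> n \<omega>)) \<le>
      (\<Sum>i = 1..n. \<Sum>s\<in>F. gain \<Delta>0 s (X i \<omega>)) + real n * (2 * b * (\<Sum>s\<in>D n - F. row_norm \<Delta>0 s)
        + 4 * b * norm1 (\<Delta> n \<omega> - \<Delta>0))"
    if n: "n \<ge> 1" and \<omega>: "\<omega> \<in> space P" and \<Delta>0: "\<Delta>0 \<in> sym_mats1" and \<Delta>n: "\<Delta> n \<omega> \<in> sym_mats1"
      and F: "F \<subseteq> D n" "\<And>s l. s \<in> F \<Longrightarrow> \<theta>star s l \<noteq> 0 \<Longrightarrow> l \<in> D n"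
    for n \<omega> \<Delta>0 F
  proof -
    define H where "H = \<theta>hat n \<omega>"
    define T where "T = truncate (D n) \<theta>star"
    have \<Delta>eq: "\<Delta> n \<omega> = H - T" by (simp add: \<Delta>_def H_def T_def)
    have fin: "finite (D n)" by (rule D_finite[OF n])
    have T: "T \<in> fin_mats (D n)" unfolding T_def by (rule truncate_in_fin_mats[OF theta_star])
    note amax = theta_hat_argmax[OF n \<omega>, folded H_def]
    have H: "H \<in> fin_mats (D n)" using amax by (simp add: Argmax_def)
    have Q: "pen_pseudo_lik \<rho> A B0 B (q (lam n)) (D n) n (\<lambda>i. X i \<omega>) \<theta> =
        (\<Sum>i = 1..n. \<Sum>s\<in>D n. loglik \<theta> s (X i \<omega>)) - (\<Sum>(s, l)\<in>lower_pairs (D n). q (lam n) \<bar>\<theta> s l\<bar>)"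
      if "\<theta> \<in> fin_mats (D n)" for \<theta>
      unfolding pen_pseudo_lik_def loglik_def cond_density_fin_mats[OF that] ..
    have "(\<Sum>i = 1..n. \<Sum>s\<in>D n. loglik T s (X i \<omega>)) - (\<Sum>(s, l)\<in>lower_pairs (D n). q (lam n) \<bar>T s l\<bar>) \<le>
        (\<Sum>i = 1..n. \<Sum>s\<in>D n. loglik H s (X i \<omega>)) - (\<Sum>(s, l)\<in>lower_pairs (D n). q (lam n) \<bar>H s l\<bar>)"
      \<comment> \<open>The truncated true matrix is an admissible competitor of the
        maximizer.\<close>
      using Argmax_ge[OF amax T] unfolding Q[OF T] Q[OF H] .
    moreover have "(\<Sum>(s, l)\<in>lower_pairs (D n). q (lam n) \<bar>T s l\<bar>)
        - (\<Sum>(s, l)\<in>lower_pairs (D n). q (lam n) \<bar>H s l\<bar>) \<le> C * lam n * norm1 (H - T)"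
      by (rule penalty_diff_le[OF lip[OF lam_pos[OF n]]])
         (use C0 lam_pos[OF n] \<Delta>n fin in \<open>auto simp: \<Delta>eq\<close>)
    ultimately have "- (C * lam n * norm1 (H - T)) \<le>
        (\<Sum>i = 1..n. \<Sum>s\<in>D n. loglik H s (X i \<omega>) - loglik T s (X i \<omega>))"
      by (simp add: sum_subtractf)
    also have "\<dots> \<le> (\<Sum>i = 1..n. (\<Sum>s\<in>F. gain \<Delta>0 s (X i \<omega>)) + (2 * b * (\<Sum>s\<in>D n - F. row_norm \<Delta>0 s)
        + 4 * b * norm1 (H - T - \<Delta>0)))"
    proof (rule sum_mono)
      fix i assume i: "i \<in> {1..n}"
      \<comment> \<open>Truncation leaves a row of \<open>F\<close> unchanged, since all its nonzero
        entries sit inside \<open>D n\<close>.\<close>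
      have Ts: "T s = \<theta>star s" if "s \<in> F" for s
        using F that by (auto simp: T_def truncate_def fun_eq_iff)
      have "(\<Sum>s\<in>D n. loglik H s (X i \<omega>) - loglik T s (X i \<omega>)) \<le>
          (\<Sum>s\<in>F. gain \<Delta>0 s (X i \<omega>)) + 2 * b * (\<Sum>s\<in>D n - F. row_norm \<Delta>0 s)
             + 2 * b * (\<Sum>s\<in>D n. row_norm (H - T - \<Delta>0) s)"
        using loglik_sum_diff_le[OF fin F(1) Ts fin_mats_row_summable[OF fin H]
            fin_mats_row_summable[OF fin T] sym_mats_row_summable[of \<Delta>0] Xsp[of i, OF _ \<omega>]]
          \<Delta>0 i by (auto simp: sym_mats1_def)
      \<comment> \<open>Summed row norms count each off-diagonal entry twice; this turns the
        constant \<open>2 * b\<close> into \<open>4 * b\<close>.\<close>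
      moreover have "2 * b * (\<Sum>s\<in>D n. row_norm (H - T - \<Delta>0) s) \<le> 2 * b * (2 * norm1 (H - T - \<Delta>0))"
        using sym_mats1_diff[OF \<Delta>n \<Delta>0] b_nonneg unfolding \<Delta>eq
        by (intro mult_left_mono sum_row_norm_le) auto
      ultimately show "(\<Sum>s\<in>D n. loglik H s (X i \<omega>) - loglik T s (X i \<omega>)) \<le>
          (\<Sum>s\<in>F. gain \<Delta>0 s (X i \<omega>)) + (2 * b * (\<Sum>s\<in>D n - F. row_norm \<Delta>0 s)
             + 4 * b * norm1 (H - T - \<Delta>0))"
        by simp
    qed
    also have "\<dots> = (\<Sum>i = 1..n. \<Sum>s\<in>F. gain \<Delta>0 s (X i \<omega>))
        + real n * (2 * b * (\<Sum>s\<in>D n - F. row_norm \<Delta>0 s) + 4 * b * norm1 (H - T - \<Delta>0))"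
      by (simp add: sum.distrib)
    finally show ?thesis unfolding \<Delta>eq .
  qed

  \<comment> \<open>Outside the events \<open>bad n\<close>, whose probabilities vanish, the error
    eventually avoids the open ball of radius \<open>r\<close> around \<open>\<Delta>0\<close>. The
    events are measurable for the sake of a later union bound; membership in
    \<open>sym_mats1\<close> will be supplied by the compact set.\<close>
  define excludes where "excludes \<Delta>0 r bad \<longleftrightarrow> r > 0 \<and> (\<forall>n. bad n \<in> sets P) \<and>
      (\<lambda>n. measure P (bad n)) \<longlonglongrightarrow> 0 \<and>
      (\<forall>\<^sub>F n in sequentially. \<forall>\<omega>\<in>space P. \<Delta> n \<omega> \<in> sym_mats1 \<longrightarrow>
         norm1 (\<Delta> n \<omega> - \<Delta>0) < r \<longrightarrow> \<omega> \<in> bad n)"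
    for \<Delta>0 :: "'s \<Rightarrow> 's \<Rightarrow> real" and r :: real and bad :: "nat \<Rightarrow> 'w set"

  \<comment> \<open>Excluding a ball around a fixed nonzero matrix\<close>
  have key: "\<exists>r bad. excludes \<Delta>0 r bad"
    if \<Delta>0: "\<Delta>0 \<in> sym_mats1" and nz: "\<Delta>0 \<noteq> 0" for \<Delta>0
  proof -
    have row: "row_summable \<Delta>0 s" for s
      using \<Delta>0 sym_mats_row_summable by (auto simp: sym_mats1_def)
    obtain s0 l0 where s0: "\<Delta>0 s0 l0 \<noteq> 0" using nz by (auto simp: fun_eq_iff)
    \<comment> \<open>\<open>h\<close> is the expected Kullback-Leibler divergence at a site whose
      row in \<open>\<Delta>0\<close> is nonzero. All tolerances below are fractions of it.\<close>
    define h where "h = - (\<integral>x. gain \<Delta>0 s0 x \<partial>\<mu>)"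
    have h: "h > 0"
    proof -
      have "pos_def_matrix (cov_matrix \<rho> A B0 B \<mu> \<theta>star s0)" by (rule cov_pos_def[OF theta_star])
      then have "(\<Sum>\<^sub>\<infinity>(l, l')\<in>UNIV. \<Delta>0 s0 l * \<Delta>0 s0 l' * cov_matrix \<rho> A B0 B \<mu> \<theta>star s0 l l') > 0"
        using s0 row[of s0] unfolding pos_def_matrix_def row_summable_def by blast
      moreover obtain \<kappa> where "\<kappa> > 0" "(\<integral>x. gain \<Delta>0 s0 x \<partial>\<mu>) \<le> - \<kappa> *
           (\<Sum>\<^sub>\<infinity>(l, l')\<in>UNIV. \<Delta>0 s0 l * \<Delta>0 s0 l' * cov_matrix \<rho> A B0 B \<mu> \<theta>star s0 l l')"
        using expected_gain(1)[OF row] by blast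
      ultimately show ?thesis
        unfolding h_def by (smt (verit) mult_minus_left mult_pos_pos)
    qed
    \<comment> \<open>Chosen so that the tail error \<open>2 * b * e\<close> and the approximation
      error \<open>4 * b * r\<close> are each at most \<open>h / 8\<close>; \<open>b + 1\<close>
      replaces \<open>b\<close> to allow \<open>b = 0\<close>.\<close>
    define e where "e = h / (16 * (b + 1))"
    define r where "r = h / (32 * (b + 1))"
    have b1: "b + 1 > 0" using b_nonneg by simp
    have e: "e > 0" and r: "r > 0" unfolding e_def r_def using h b1 by auto
    have be: "2 * b * e \<le> h / 8" and br: "4 * b * r \<le> h / 8"
      unfolding e_def r_def using h b_nonneg by (auto simp: field_simps)
    obtain F0 where F0: "finite F0" "\<And>G. finite G \<Longrightarrow> G \<inter> F0 = {} \<Longrightarrow> sum (row_norm \<Delta>0) G \<le> e"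
      using summable_tail_real[OF row_norm_nonneg row_norm_summable(1)[OF \<Delta>0] e] by blast
    \<comment> \<open>\<open>F0\<close> carries all but \<open>e\<close> of the row norms, while
      \<open>s0\<close> guarantees the drift \<open>- h\<close>.\<close>
    define F where "F = insert s0 F0"
    have F: "finite F" using F0 by (simp add: F_def)
    define g where "g x = (\<Sum>s\<in>F. gain \<Delta>0 s x)" for x
    have gm[measurable]: "g \<in> borel_measurable \<mu>"
      unfolding g_def[abs_def] by (intro borel_measurable_sum gain_meas row)
    have gint: "integrable \<mu> (gain \<Delta>0 s)" for s
      by (rule mu.integrable_const_bound[where B = "2 * b * row_norm \<Delta>0 s"])
         (use gain_le[OF row] gain_meas[OF row] in auto)
    have gb: "\<bar>g x\<bar> \<le> (\<Sum>s\<in>F. 2 * b * row_norm \<Delta>0 s)" if "x \<in> space \<mu>" for x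
      unfolding g_def by (rule order_trans[OF sum_abs sum_mono]) (rule gain_le[OF row that])
    have gE: "(\<integral>x. g x \<partial>\<mu>) \<le> - h"
    proof -
      have "(\<integral>x. g x \<partial>\<mu>) = (\<Sum>s\<in>F. \<integral>x. gain \<Delta>0 s x \<partial>\<mu>)"
        unfolding g_def using gint by (intro Bochner_Integration.integral_sum) auto
      also have "\<dots> = - h + (\<Sum>s\<in>F - {s0}. \<integral>x. gain \<Delta>0 s x \<partial>\<mu>)"
        using F by (subst sum.remove[of F s0]) (auto simp: F_def h_def)
      also have "\<dots> \<le> - h"
        using sum_nonpos[of "F - {s0}" "\<lambda>s. \<integral>x. gain \<Delta>0 s x \<partial>\<mu>"] expected_gain(2)[OF row] by simp
      finally show ?thesis .
    qed
    define bad where "bad n = {\<omega> \<in> space P. (\<Sum>i = 1..n. g (X i \<omega>)) \<ge> - (real n * h / 2)}" for n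
    have lim: "(\<lambda>n. measure P (bad n)) \<longlonglongrightarrow> 0"
      unfolding bad_def by (rule weak_law_upper[OF P_prob X_indep X_law gm gb gE h])
    have meas: "bad n \<in> sets P" for n
    proof -
      have [measurable]: "(\<lambda>\<omega>. \<Sum>i = 1..n. g (X i \<omega>)) \<in> borel_measurable P"
        by (intro borel_measurable_sum measurable_compose[OF Xm gm]) auto
      show ?thesis unfolding bad_def by measurable
    qed
    \<comment> \<open>Once \<open>D n\<close> contains \<open>F\<close> and all neighbours of its
      sites, truncation does not touch the rows of \<open>F\<close>.\<close>
    define W where "W = F \<union> (\<Union>s\<in>F. {l \<in> UNIV - {s}. \<theta>star s l \<noteq> 0})"
    have "finite W" unfolding W_def using F theta_star_nbhd by blast
    then obtain N where N: "N \<ge> 1" "\<And>n. n \<ge> N \<Longrightarrow> W \<subseteq> D n"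
      using finite_subset_increasing_union[OF D_mono D_union] by blast
    have norm0: "norm1 \<Delta>0 \<ge> 0" unfolding norm1_def by (rule infsum_nonneg) auto
    \<comment> \<open>On the ball the error has norm at most \<open>norm1 \<Delta>0 + r\<close>, so
      this is the penalty contribution per observation.\<close>
    have "(\<lambda>n. C * (norm1 \<Delta>0 + r) * (lam n / real n)) \<longlonglongrightarrow> C * (norm1 \<Delta>0 + r) * 0"
      by (intro tendsto_intros lam_rate)
    then have "\<forall>\<^sub>F n in sequentially. C * (norm1 \<Delta>0 + r) * (lam n / real n) < h / 8"
      using h by (intro order_tendstoD(2)) auto
    with eventually_ge_at_top[of N]
    have "\<forall>\<^sub>F n in sequentially. \<forall>\<omega>\<in>space P. \<Delta> n \<omega> \<in> sym_mats1 \<longrightarrow> norm1 (\<Delta> n \<omega> - \<Delta>0) < r \<longrightarrow> \<omega> \<in> bad n"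
    proof eventually_elim
      case (elim n)
      have n: "n \<ge> 1" using elim N by simp
      show ?case
      proof (intro ballI impI)
        fix \<omega> assume \<omega>: "\<omega> \<in> space P" and \<Delta>n: "\<Delta> n \<omega> \<in> sym_mats1" and close: "norm1 (\<Delta> n \<omega> - \<Delta>0) < r"
        have WD: "W \<subseteq> D n" using N(2) elim by blast
        have FD: "F \<subseteq> D n" using WD by (auto simp: W_def)
        have nbhd: "l \<in> D n" if "s \<in> F" "\<theta>star s l \<noteq> 0" for s l
          using that WD FD by (cases "l = s") (auto simp: W_def)
        have c: "- (C * lam n * norm1 (\<Delta> n \<omega>)) \<le>
            (\<Sum>i = 1..n. \<Sum>s\<in>F. gain \<Delta>0 s (X i \<omega>)) + real n * (2 * b * (\<Sum>s\<in>D n - F. row_norm \<Delta>0 s)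
              + 4 * b * norm1 (\<Delta> n \<omega> - \<Delta>0))"
          by (rule core[OF n \<omega> \<Delta>0 \<Delta>n FD]) (rule nbhd)
        have "sum (row_norm \<Delta>0) (D n - F) \<le> e"
          by (rule F0(2)) (use D_finite[OF n] in \<open>auto simp: F_def\<close>)
        then have t1: "2 * b * (\<Sum>s\<in>D n - F. row_norm \<Delta>0 s) \<le> h / 8"
          using be b_nonneg mult_left_mono[of "sum (row_norm \<Delta>0) (D n - F)" e "2 * b"] by simp
        have t2: "4 * b * norm1 (\<Delta> n \<omega> - \<Delta>0) \<le> h / 8"
          using br b_nonneg close mult_left_mono[of "norm1 (\<Delta> n \<omega> - \<Delta>0)" r "4 * b"] by simp
        have zero: "(\<lambda>_ _. 0) \<in> (sym_mats1 :: ('s \<Rightarrow> 's \<Rightarrow> real) set)"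
          by (simp add: sym_mats1_def sym_mats_def case_prod_unfold)
        have "norm1 (\<Delta> n \<omega> - (\<lambda>_ _. 0)) \<le> norm1 (\<Delta> n \<omega> - \<Delta>0) + norm1 (\<Delta>0 - (\<lambda>_ _. 0))"
          by (rule M1.triangle[OF \<Delta>n \<Delta>0 zero])
        then have "norm1 (\<Delta> n \<omega>) \<le> norm1 \<Delta>0 + r"
          using close by (simp add: fun_diff_def)
        then have "C * lam n * norm1 (\<Delta> n \<omega>) \<le> C * lam n * (norm1 \<Delta>0 + r)"
          using C0 lam_pos[OF n] by (intro mult_left_mono) auto
        also have "\<dots> = real n * (C * (norm1 \<Delta>0 + r) * (lam n / real n))"
          using n by simp
        also have "\<dots> \<le> real n * (h / 8)"
          using elim by (intro mult_left_mono) auto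
        finally have t3: "C * lam n * norm1 (\<Delta> n \<omega>) \<le> real n * (h / 8)" .
        have t12: "real n * (2 * b * (\<Sum>s\<in>D n - F. row_norm \<Delta>0 s) + 4 * b * norm1 (\<Delta> n \<omega> - \<Delta>0))
            \<le> real n * (h / 8 + h / 8)"
          by (rule mult_left_mono[OF add_mono[OF t1 t2]]) simp
        \<comment> \<open>Penalty, tail and approximation cost at most \<open>h / 8\<close> each per
          observation, together \<open>3 * h / 8\<close>, which is below the threshold
          \<open>h / 2\<close>.\<close>
        have "- (real n * h / 2) \<le> - (real n * (h / 8)) - real n * (h / 8 + h / 8)"
          using h mult_nonneg_nonneg[of "real n" h] by (simp add: algebra_simps)
        also have "\<dots> \<le> (\<Sum>i = 1..n. g (X i \<omega>))"
          using c t3 t12 unfolding g_def by linarith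
        finally show "\<omega> \<in> bad n"
          using \<omega> by (simp add: bad_def)
      qed
    qed
    then show ?thesis using r meas lim unfolding excludes_def by blast
  qed

  then obtain r bad where rb: "\<And>\<Delta>0. \<Delta>0 \<in> sym_mats1 \<Longrightarrow> \<Delta>0 \<noteq> 0 \<Longrightarrow> excludes \<Delta>0 (r \<Delta>0) (bad \<Delta>0)"
    by metis
  have r: "r \<Delta>0 > 0"
    and bad: "\<And>n. bad \<Delta>0 n \<in> sets P" "(\<lambda>n. measure P (bad \<Delta>0 n)) \<longlonglongrightarrow> 0"
    and excl: "\<forall>\<^sub>F n in sequentially. \<forall>\<omega>\<in>space P. \<Delta> n \<omega> \<in> sym_mats1 \<longrightarrow>
        norm1 (\<Delta> n \<omega> - \<Delta>0) < r \<Delta>0 \<longrightarrow> \<omega> \<in> bad \<Delta>0 n"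
    if "\<Delta>0 \<in> sym_mats1" "\<Delta>0 \<noteq> 0" for \<Delta>0
    using rb[OF that] unfolding excludes_def by blast+

  \<comment> \<open>Reduction to finitely many balls by tightness\<close>
  show ?thesis
    unfolding tendsto_in_prob_def \<Delta>_def[symmetric]
  proof (intro allI impI)
    fix \<delta> :: real assume \<delta>: "\<delta> > 0"
    define E where "E n = {\<omega> \<in> space P. \<bar>norm1 (\<Delta> n \<omega>) - 0\<bar> > \<delta>}" for n
    have "\<forall>\<^sub>F n in sequentially. measure P (E n) < \<eta>" if \<eta>: "\<eta> > 0" for \<eta>
    proof -
      \<comment> \<open>Half of \<open>\<eta>\<close> is reserved for the bad events. The cap
        \<open>1 / 2\<close> keeps \<open>1 - \<eta>'\<close> positive, which the measurability
        argument for \<open>?G\<close> relies on.\<close>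
      define \<eta>' where "\<eta>' = min (\<eta> / 2) (1 / 2)"
      have \<eta>': "\<eta>' > 0" "\<eta>' \<le> \<eta> / 2" "\<eta>' \<le> 1 / 2" using \<eta> by (auto simp: \<eta>'_def)
      obtain K where K: "compactin top1 K"
        "\<And>n. n \<ge> 1 \<Longrightarrow> measure P {\<omega> \<in> space P. \<Delta> n \<omega> \<in> K} \<ge> 1 - \<eta>'"
        using tight \<eta>'(1) unfolding uniformly_tight_def \<Delta>_def by fastforce
      have K1: "K \<subseteq> sym_mats1"
        using compactin_subset_topspace[OF K(1)] by (simp add: top1_def)
      \<comment> \<open>No exclusion is available around 0; there the ball has radius
        \<open>\<delta>\<close>, inside which the error is already as small as claimed.\<close>
      define U where "U \<Delta>0 = M1.mball \<Delta>0 (if \<Delta>0 = 0 then \<delta> else r \<Delta>0)" for \<Delta>0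
      have "\<exists>\<F>. finite \<F> \<and> \<F> \<subseteq> U ` K \<and> K \<subseteq> \<Union>\<F>"
      proof (rule compactinD[OF K(1)])
        show "openin top1 V" if "V \<in> U ` K" for V
          using that by (auto simp: U_def top1_def)
        show "K \<subseteq> \<Union> (U ` K)"
        proof
          fix \<Delta>0 assume "\<Delta>0 \<in> K"
          then have "\<Delta>0 \<in> U \<Delta>0"
            unfolding U_def using K1 \<delta> r[of \<Delta>0] by (intro M1.centre_in_mball_iff[THEN iffD2]) auto
          with \<open>\<Delta>0 \<in> K\<close> show "\<Delta>0 \<in> \<Union> (U ` K)" by blast
        qed
      qed
      then obtain K0 where K0: "finite K0" "K0 \<subseteq> K" "K \<subseteq> \<Union> (U ` K0)"
        by (metis finite_subset_image)
      define K0' where "K0' = K0 - {0}"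
      have K0': "finite K0'" "\<And>\<Delta>0. \<Delta>0 \<in> K0' \<Longrightarrow> \<Delta>0 \<in> sym_mats1 \<and> \<Delta>0 \<noteq> 0"
        using K0 K1 by (auto simp: K0'_def)
      have "\<forall>\<^sub>F n in sequentially. \<forall>\<Delta>0\<in>K0'. \<forall>\<omega>\<in>space P.
          \<Delta> n \<omega> \<in> sym_mats1 \<longrightarrow> norm1 (\<Delta> n \<omega> - \<Delta>0) < r \<Delta>0 \<longrightarrow> \<omega> \<in> bad \<Delta>0 n"
        using K0' excl by (intro eventually_ball_finite) auto
      moreover have "(\<lambda>n. \<Sum>\<Delta>0\<in>K0'. measure P (bad \<Delta>0 n)) \<longlonglongrightarrow> (\<Sum>\<Delta>0\<in>K0'. 0)"
        using K0' bad(2) by (intro tendsto_sum) auto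
      then have "\<forall>\<^sub>F n in sequentially. (\<Sum>\<Delta>0\<in>K0'. measure P (bad \<Delta>0 n)) < \<eta> / 2"
        using \<eta> by (intro order_tendstoD(2)) auto
      ultimately show ?thesis
        using eventually_ge_at_top[of 1]
      proof eventually_elim
        case (elim n)
        let ?G = "{\<omega> \<in> space P. \<Delta> n \<omega> \<in> K}"
        have GP: "measure P ?G \<ge> 1 - \<eta>'" by (rule K(2)[OF elim(3)])
        \<comment> \<open>A set outside the sigma-algebra has \<open>measure\<close> 0 by
          convention, so the positive lower bound forces measurability.\<close>
        have G: "?G \<in> sets P"
          using GP \<eta>'(3) measure_notin_sets[of ?G P] by fastforce
        have sub: "E n \<subseteq> (space P - ?G) \<union> (\<Union>\<Delta>0\<in>K0'. bad \<Delta>0 n)"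
        proof
          fix \<omega> assume "\<omega> \<in> E n"
          then have \<omega>: "\<omega> \<in> space P" and big: "\<bar>norm1 (\<Delta> n \<omega>)\<bar> > \<delta>" by (auto simp: E_def)
          show "\<omega> \<in> (space P - ?G) \<union> (\<Union>\<Delta>0\<in>K0'. bad \<Delta>0 n)"
          proof (cases "\<Delta> n \<omega> \<in> K")
            case True
            then obtain \<Delta>0 where \<Delta>0: "\<Delta>0 \<in> K0" "\<Delta> n \<omega> \<in> U \<Delta>0" using K0(3) by blast
            have nn: "norm1 (\<Delta> n \<omega>) \<ge> 0" unfolding norm1_def by (rule infsum_nonneg) auto
            have "\<Delta>0 \<noteq> 0"
            proof
              assume "\<Delta>0 = 0"
              then have "norm1 (0 - \<Delta> n \<omega>) < \<delta>" using \<Delta>0(2) by (simp add: U_def)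
              moreover have "norm1 (0 - \<Delta> n \<omega>) = norm1 (\<Delta> n \<omega>)" by (simp add: norm1_def)
              ultimately show False using big nn by simp
            qed
            then have "norm1 (\<Delta>0 - \<Delta> n \<omega>) < r \<Delta>0" using \<Delta>0(2) by (simp add: U_def)
            then have "norm1 (\<Delta> n \<omega> - \<Delta>0) < r \<Delta>0" using M1.commute[of \<Delta>0 "\<Delta> n \<omega>"] by simp
            then have "\<omega> \<in> bad \<Delta>0 n"
              using elim(1) \<omega> True K1 \<Delta>0(1) \<open>\<Delta>0 \<noteq> 0\<close> by (auto simp: K0'_def)
            then show ?thesis using \<Delta>0(1) \<open>\<Delta>0 \<noteq> 0\<close> by (auto simp: K0'_def)
          qed (use \<omega> in simp)
        qed
        have badm: "bad \<Delta>0 n \<in> sets P" if "\<Delta>0 \<in> K0'" for \<Delta>0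
          using K0'(2)[OF that] bad(1) by blast
        have um: "(\<Union>\<Delta>0\<in>K0'. bad \<Delta>0 n) \<in> sets P"
          using K0'(1) badm by (intro sets.finite_UN) auto
        \<comment> \<open>Monotonicity asks for measurability of the larger set only, so none is
          claimed for \<open>E n\<close>.\<close>
        have "measure P (E n) \<le> measure P ((space P - ?G) \<union> (\<Union>\<Delta>0\<in>K0'. bad \<Delta>0 n))"
          using sub G um by (intro P.finite_measure_mono) auto
        also have "\<dots> \<le> measure P (space P - ?G) + measure P (\<Union>\<Delta>0\<in>K0'. bad \<Delta>0 n)"
          using G um by (intro measure_Un_le) auto
        also have "\<dots> \<le> \<eta> / 2 + (\<Sum>\<Delta>0\<in>K0'. measure P (bad \<Delta>0 n))"
        proof (rule add_mono)
          show "measure P (space P - ?G) \<le> \<eta> / 2"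
            using GP \<eta>'(2) P.prob_compl[OF G] by simp
          show "measure P (\<Union>\<Delta>0\<in>K0'. bad \<Delta>0 n) \<le> (\<Sum>\<Delta>0\<in>K0'. measure P (bad \<Delta>0 n))"
            using K0'(1) badm by (intro measure_UNION_le) auto
        qed
        also have "\<dots> < \<eta>" using elim(2) by simp
        finally show ?case .
      qed
    qed
    then show "(\<lambda>n. measure P {\<omega> \<in> space P. \<bar>norm1 (\<Delta> n \<omega>) - 0\<bar> > \<delta>}) \<longlonglongrightarrow> 0"
      unfolding E_def[symmetric]
    proof (intro order_tendstoI)
      show "\<forall>\<^sub>F n in sequentially. c < measure P (E n)" if "c < 0" for c
        by (intro always_eventually allI less_le_trans[OF that measure_nonneg])
    qed
  qed
qed

end
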